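(* Let $q$ be a prime power. (1) Suppose that $\mathrm{PG}(3,q)$ has Property E. Then $\chi'(\mathrm{PG}(n,q))=\frac{q^n-1}{q-1}$ for any odd integer $n\geq 5$. (2) Suppose that $\mathrm{PG}(3,q)$ has Property E and that $\chi'(\mathrm{PG}(4,q))=\frac{q^4-1}{q-1}+q+1$. If $\mathrm{IPG}(4,q;2)$ is $\left(\frac{q^4-1}{q-1}+q+1\right)$-colorable, where $q^2(q+1)$ colors are used to color all lines incident with the given $\mathrm{PG}(2,q)$, then $\chi'(\mathrm{PG}(n,q))=\frac{q^n-1}{q-1}+q+1$ for any even integer $n\geq 6$.
   Context: $\mathrm{PG}(n,q)$ denotes the $n$-dimensional projective space over the finite field $\mathbb{F}_q$: its $d$-subspaces are the $(d+1)$-dimensional subspaces of the $(n+1)$-dimensional vector space over $\mathbb{F}_q$; 0-subspaces are points and 1-subspaces are lines. Two lines intersect if they have a common point. A line coloring is a mapping from the set of lines to a set of colors such that any two distinct intersecting lines have different colors. The chromatic index $\chi'(\mathrm{PG}(n,q))$ is the least number of colors for which a line coloring of $\mathrm{PG}(n,q)$ exists. A spread of $\mathrm{PG}(3,q)$ is a set of pairwise disjoint lines that partitions the points of $\mathrm{PG}(3,q)$. $\mathrm{PG}(3,q)$ is said to have Property E if it contains a special spread $P$ and a collection $\mathcal{S}$ (repeated members allowed, counted with multiplicity) of $\frac{q^4-1}{q-1}=(q^2+1)(q+1)$ spreads such that: (1) for each line $l$ in $P$, there are exactly $q+1$ spreads in $\mathcal{S}$ containing $l$; (2) for each line $l$ not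 in $P$, there are exactly $q$ spreads in $\mathcal{S}$ containing $l$; and (3) no spread in $\mathcal{S}$ contains two distinct lines of $P$. Given an $(n-2)$-subspace $\mathrm{PG}(n-2,q)$ of $\mathrm{PG}(n,q)$, $\mathrm{IPG}(n,q;n-2)$ denotes the geometry obtained from $\mathrm{PG}(n,q)$ by removing all lines of the given $\mathrm{PG}(n-2,q)$ (its points are all points of $\mathrm{PG}(n,q)$). It is $c$-colorable if its lines can be colored with $c$ colors so that any two distinct intersecting lines have different colors. A line of $\mathrm{IPG}(n,q;n-2)$ is incident with the given $\mathrm{PG}(n-2,q)$ if it contains a point of it. The phrase "where $m$ colors are used to color all lines incident with the given $\mathrm{PG}(n-2,q)$" means that in the $c$-coloring in question the set of colors occurring on these lines has size $m$ (these colors may also occur on other lines). *)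

theory Defs
  imports "HOL-Library.Function_Algebras" "HOL-Library.Cardinality" "HOL-Library.Multiset" "HOL-Number_Theory.Prime_Powers"
begin

(* The field F_q is a finite field type 'a with CARD('a) = q.  Vectors are functions
   nat => 'a; the (n+1)-dimensional space underlying PG(n,q) is the set of those
   supported on {0..n}, so that n can be an ordinary natural number. *)

definition fscale :: "'a::field \<Rightarrow> (nat \<Rightarrow> 'a) \<Rightarrow> (nat \<Rightarrow> 'a)" where
  "fscale c v = (\<lambda>i. c * v i)"

global_interpretation fvs: vector_space "fscale :: 'a::field \<Rightarrow> (nat \<Rightarrow> 'a) \<Rightarrow> (nat \<Rightarrow> 'a)"
  by unfold_locales (auto simp: fscale_def plus_fun_def algebra_simps)

type_synonym 'a flat = "(nat \<Rightarrow> 'a) set"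

definition ambient :: "nat \<Rightarrow> 'a::field flat" where
  "ambient n = {v. \<forall>i>n. v i = 0}"

(* A projective d-subspace has vector space dimension d + 1. *)
definition is_flat :: "nat \<Rightarrow> 'a::field flat \<Rightarrow> bool" where
  "is_flat d S \<longleftrightarrow> fvs.subspace S \<and> fvs.dim S = d + 1"

definition pg_subspaces :: "nat \<Rightarrow> nat \<Rightarrow> 'a::field flat set" where
  "pg_subspaces n d = {S. is_flat d S \<and> S \<subseteq> ambient n}"

abbreviation pg_points :: "nat \<Rightarrow> 'a::field flat set" where
  "pg_points n \<equiv> pg_subspaces n 0"

abbreviation pg_lines :: "nat \<Rightarrow> 'a::field flat set" where
  "pg_lines n \<equiv> pg_subspaces n 1"

definition intersecting :: "'a::field flat \<Rightarrow> 'a flat \<Rightarrow> bool" where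
  "intersecting S T \<longleftrightarrow> (\<exists>p. is_flat 0 p \<and> p \<subseteq> S \<and> p \<subseteq> T)"

definition line_coloring :: "'a::field flat set \<Rightarrow> nat \<Rightarrow> ('a flat \<Rightarrow> nat) \<Rightarrow> bool" where
  "line_coloring L c f \<longleftrightarrow>
     (\<forall>l\<in>L. f l < c) \<and>
     (\<forall>l\<in>L. \<forall>m\<in>L. l \<noteq> m \<and> intersecting l m \<longrightarrow> f l \<noteq> f m)"

(* For a finite geometry the set of admissible c is nonempty, so the LEAST is attained. *)
definition chromatic_index :: "'a::field flat set \<Rightarrow> nat" where
  "chromatic_index L = (LEAST c. \<exists>f. line_coloring L c f)"

definition spread :: "'a::field flat set \<Rightarrow> bool" where
  "spread S \<longleftrightarrow>
     S \<subseteq> pg_lines 3 \<and>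
     (\<forall>l\<in>S. \<forall>m\<in>S. l \<noteq> m \<longrightarrow> \<not> intersecting l m) \<and>
     (\<forall>p\<in>pg_points 3. \<exists>l\<in>S. p \<subseteq> l)"

(* P is the special spread; spreads may be repeated, hence the multiset. *)
definition property_E :: "'a::{field,finite} itself \<Rightarrow> bool" where
  "property_E _ \<longleftrightarrow> (let q = CARD('a) in
     \<exists>(P :: 'a flat set) (\<S> :: 'a flat set multiset).
       spread P \<and> (\<forall>S\<in>#\<S>. spread S) \<and>
       size \<S> = (q ^ 4 - 1) div (q - 1) \<and>
       (\<forall>l\<in>P. size {#S \<in># \<S>. l \<in> S#} = q + 1) \<and>
       (\<forall>l\<in>pg_lines 3 - P. size {#S \<in># \<S>. l \<in> S#} = q) \<and>
       (\<forall>S\<in>#\<S>. \<not> (\<exists>l\<in>P. \<exists>m\<in>P. l \<noteq> m \<and> l \<in> S \<and> m \<in> S)))"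

(* IPG(n,q;n-2) is described by its lines; H is the given (n-2)-subspace. *)
definition ipg_lines :: "nat \<Rightarrow> 'a::field flat \<Rightarrow> 'a flat set" where
  "ipg_lines n H = {l \<in> pg_lines n. \<not> l \<subseteq> H}"

definition ipg_incident_lines :: "nat \<Rightarrow> 'a::field flat \<Rightarrow> 'a flat set" where
  "ipg_incident_lines n H = {l \<in> ipg_lines n H. intersecting l H}"

end

theory Submission
  imports Defs "HOL-Library.FuncSet"
begin

text \<open>The lower bounds come from counting incident pairs of a point and a line. A point lies on
  \<open>\<theta> = (q\<^sup>n - 1) / (q - 1)\<close> lines, which need pairwise different colors; this settles odd \<open>n\<close>. For even
  \<open>n\<close> a set of pairwise disjoint lines misses at least \<open>q\<^sup>2\<close> points (\<open>partial_spread_holes\<close>, by counting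
  the missed points in all hyperplanes), so \<open>c\<close> colors cover too few incidences unless
  \<open>c \<ge> \<theta> + q + 1\<close>.

  The colorings are built by recursion from \<open>n - 2\<close> to \<open>n\<close>. Write the vector space as \<open>X \<oplus> U\<close> with \<open>X\<close>
  of dimension four, and let \<open>P\<close> and \<open>S\<^sub>i\<close> be the spreads of \<open>X\<close> provided by Property E. A line either
  lies in one of the subspaces \<open>y \<oplus> U\<close> with \<open>y \<in> P\<close>, which are copies of the space of dimension
  \<open>n - 2\<close> that share \<open>U\<close>, or it is the graph of a linear map to \<open>U\<close> from a line \<open>m \<notin> P\<close> of \<open>X\<close>. The
  graphs over \<open>m\<close> split into \<open>|U|\<close> classes of pairwise disjoint lines (\<open>lift_labelling\<close>: linear
  maps whose pairwise differences are injective), and as \<open>m\<close> lies in exactly \<open>q\<close> of the spreads \<open>S\<^sub>i\<close>, there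
  is one color \<open>(i, j)\<close> with \<open>m \<in> S\<^sub>i\<close> and \<open>j < |U| / q\<close> for each of these classes. On the graphs, a color
  \<open>(i, j)\<close> avoids \<open>y \<oplus> U\<close> for the line \<open>y \<in> P\<close> that belongs to \<open>S\<^sub>i\<close>. There are
  exactly as many such colors for a given \<open>y\<close> as a coloring of \<open>y \<oplus> U\<close> with hole \<open>U\<close> uses on the lines
  meeting \<open>U\<close>; they are reused for these lines. The remaining colors of the fillings avoid \<open>U\<close>, so they
  can be shared by all \<open>y\<close>; in one chosen \<open>y\<^sub>0 \<oplus> U\<close> a coloring of all lines, including those
  of \<open>U\<close>, is used instead. The result is a coloring of the whole space, and it restricts to a coloring
  with hole \<open>y\<^sub>0 \<oplus> U\<close>, so that the recursion continues (\<open>frame_coloring\<close>, \<open>dimension_step\<close>). The number of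
  colors exceeds \<open>\<theta>\<close> by the same amount in all dimensions of the same parity.

  In even dimension the recursion starts from the two assumed colorings in dimension four. In odd
  dimension it starts from a parallelism of the three-dimensional space, that is, a coloring with
  \<open>q\<^sup>2 + q + 1\<close> colors, which exists over every finite field. For \<open>q \<ge> 3\<close> the ring of two by two matrices
  contains two different quadratic extension fields \<open>K\<close> and \<open>K'\<close>. The spread of \<open>K\<close> is one color class. The
  spread of \<open>K'\<close> shares with it the regulus of the lines defined over the ground field; replacing this
  regulus by the opposite one gives a spread with no line in common with that of \<open>K\<close>, and its images
  under the central collineations \<open>(x, y) \<mapsto> (a x, b x + y)\<close> with \<open>a \<noteq> 0\<close> are the other classes. For
  \<open>q = 2\<close> there is only one such field, and a solution of Kirkman's schoolgirl problem is used.\<close>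

section \<open>Finite subspaces and their cardinalities\<close>

abbreviation flinear :: "((nat \<Rightarrow> 'a::field) \<Rightarrow> (nat \<Rightarrow> 'a)) \<Rightarrow> bool" where
  "flinear \<equiv> Vector_Spaces.linear fscale fscale"

lemma vector_space_pair_fscale:
  "vector_space_pair (fscale :: 'a::field \<Rightarrow> _) (fscale :: 'a \<Rightarrow> _)"
  by unfold_locales

lemma flinearI:
  assumes "\<And>v w. f (v + w) = f v + f w" "\<And>c v. f (fscale c v) = fscale c (f v)"
  shows "flinear f"
  using assms fvs.vector_space_axioms unfolding Vector_Spaces.linear_iff by blast

lemma flinear_simps:
  assumes "flinear f"
  shows "f (v + w) = f v + f w" "f (v - w) = f v - f w" "f (fscale c v) = fscale c (f v)" "f 0 = 0"
proof -
  interpret Vector_Spaces.linear fscale fscale f by (rule assms)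
  show "f (v + w) = f v + f w" "f (v - w) = f v - f w" "f (fscale c v) = fscale c (f v)" "f 0 = 0"
    by (simp_all add: add diff scale)
qed

lemma fscale_eq_0_iff: "fscale c v = 0 \<longleftrightarrow> c = 0 \<or> v = 0"
  by (rule fvs.scale_eq_0_iff)

lemma two_le_card_field: "2 \<le> CARD('a::{field,finite})"
proof -
  have "card {0, 1::'a} \<le> CARD('a)" by (rule card_mono) auto
  then show ?thesis by simp
qed

text \<open>All fibres of an additive map are translates of its kernel.\<close>
lemma card_eq_image_times_kernel:
  fixes f :: "'b::ab_group_add \<Rightarrow> 'c::ab_group_add"
  assumes fin: "finite S" and clos: "\<And>x y. x \<in> S \<Longrightarrow> y \<in> S \<Longrightarrow> x + y \<in> S"
    "\<And>x y. x \<in> S \<Longrightarrow> y \<in> S \<Longrightarrow> x - y \<in> S"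
    and hom: "\<And>x y. x \<in> S \<Longrightarrow> y \<in> S \<Longrightarrow> f (x - y) = f x - f y"
  shows "card S = card (f ` S) * card {x \<in> S. f x = 0}"
proof -
  have fibre: "card {x \<in> S. f x = y} = card {x \<in> S. f x = 0}" if "y \<in> f ` S" for y
  proof -
    obtain x0 where x0: "x0 \<in> S" "y = f x0" using \<open>y \<in> f ` S\<close> by blast
    have hom': "f (x + x0) = f x + f x0" if "x \<in> S" for x
      using hom[of "x + x0" x0] clos that x0 by simp
    have "bij_betw (\<lambda>x. x + x0) {x \<in> S. f x = 0} {x \<in> S. f x = y}"
      by (rule bij_betw_byWitness[where f' = "\<lambda>x. x - x0"])
         (use x0 clos hom hom' in \<open>auto\<close>)
    then show ?thesis by (simp add: bij_betw_same_card)
  qed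
  have "card S = (\<Sum>y\<in>f ` S. card {x \<in> S. f x = y})"
    using sum.image_gen[OF fin, of "\<lambda>_. 1::nat" f] by simp
  also have "\<dots> = (\<Sum>y\<in>f ` S. card {x \<in> S. f x = 0})"
    by (rule sum.cong) (use fibre in auto)
  finally show ?thesis by simp
qed

lemma card_span_independent:
  fixes B :: "(nat \<Rightarrow> 'a::{field,finite}) set"
  assumes "finite B" "fvs.independent B"
  shows "card (fvs.span B) = CARD('a) ^ card B" "finite (fvs.span B)"
proof -
  have "card (fvs.span B) = CARD('a) ^ card B \<and> finite (fvs.span B)"
    using assms
  proof (induction B rule: finite_induct)
    case empty
    then show ?case by simp
  next
    case (insert b B)
    have ind: "fvs.independent B" and nb: "b \<notin> fvs.span B"
      using insert.prems insert.hyps by (simp_all add: fvs.independent_insert)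
    have IH: "card (fvs.span B) = CARD('a) ^ card B" "finite (fvs.span B)"
      using insert.IH[OF ind] by auto
    let ?f = "\<lambda>(k, x). fscale k b + x"
    have inj: "inj_on ?f (UNIV \<times> fvs.span B)"
    proof (rule inj_onI, clarify)
      fix k x k' x'
      assume x: "x \<in> fvs.span B" "x' \<in> fvs.span B" and eq: "fscale k b + x = fscale k' b + x'"
      from eq have e: "fscale (k - k') b = x' - x"
        by (simp add: fvs.scale_left_diff_distrib algebra_simps)
      have "k = k'"
      proof (rule ccontr)
        assume "k \<noteq> k'"
        then have "b = fscale (inverse (k - k')) (x' - x)"
          unfolding e[symmetric] by simp
        then show False using nb x by (metis fvs.span_diff fvs.span_scale)
      qed
      with eq show "k = k' \<and> x = x'" by simp
    qed
    have "fvs.span (insert b B) = ?f ` (UNIV \<times> fvs.span B)"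
    proof (intro set_eqI iffI)
      fix x assume "x \<in> fvs.span (insert b B)"
      then obtain k where k: "x - fscale k b \<in> fvs.span B"
        by (auto simp: fvs.span_breakdown_eq)
      then show "x \<in> ?f ` (UNIV \<times> fvs.span B)"
        by (intro image_eqI[where x = "(k, x - fscale k b)"]) auto
    next
      fix x assume "x \<in> ?f ` (UNIV \<times> fvs.span B)"
      then obtain k y where "y \<in> fvs.span B" "x = fscale k b + y" by auto
      then show "x \<in> fvs.span (insert b B)"
        by (auto simp: fvs.span_breakdown_eq intro!: exI[of _ k])
    qed
    then show ?case
      using inj IH insert.hyps by (simp add: card_image card_cartesian_product)
  qed
  then show "card (fvs.span B) = CARD('a) ^ card B" "finite (fvs.span B)" by auto
qed

lemma finite_subspace_basis:
  fixes S :: "'a::{field,finite} flat"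
  assumes "fvs.subspace S" "finite S" "B0 \<subseteq> S" "fvs.independent B0"
  obtains B where "B0 \<subseteq> B" "B \<subseteq> S" "fvs.independent B" "fvs.span B = S"
    "finite B" "card S = CARD('a) ^ card B"
proof -
  obtain B where B: "B0 \<subseteq> B" "B \<subseteq> S" "fvs.independent B" "S \<subseteq> fvs.span B"
    using fvs.maximal_independent_subset_extend[OF assms(3,4)] by auto
  have fin: "finite B" using B assms finite_subset by blast
  have sp: "fvs.span B = S" using B assms(1) by (simp add: fvs.span_subspace)
  show ?thesis using that[OF B(1,2,3) sp fin] card_span_independent(1)[OF fin B(3)] sp by simp
qed

text \<open>Over a finite field the dimension of a subspace can be read off from its cardinality; this
  turns every dimension argument below into counting.\<close>
lemma is_flat_iff_card:
  fixes S :: "'a::{field,finite} flat"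
  shows "is_flat d S \<longleftrightarrow> fvs.subspace S \<and> card S = CARD('a) ^ (d + 1)"
proof
  assume "is_flat d S"
  then have S: "fvs.subspace S" "fvs.dim S = d + 1" by (auto simp: is_flat_def)
  obtain B where B: "B \<subseteq> S" "fvs.independent B" "S \<subseteq> fvs.span B" "card B = fvs.dim S"
    by (rule fvs.basis_exists)
  have "finite B" using B S by (metis add_is_0 card.infinite one_neq_zero)
  then show "fvs.subspace S \<and> card S = CARD('a) ^ (d + 1)"
    using S B card_span_independent(1)[of B] fvs.span_subspace[OF B(1,3) S(1)] by simp
next
  assume S: "fvs.subspace S \<and> card S = CARD('a) ^ (d + 1)"
  then have fin: "finite S" by (metis card.infinite power_not_zero finite_UNIV_card_ge_0 finite_class.finite_UNIV less_not_refl)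
  obtain B where B: "{} \<subseteq> B" "B \<subseteq> S" "fvs.independent B" "fvs.span B = S" "finite B"
    "card S = CARD('a) ^ card B"
    using finite_subspace_basis[of S "{}"] S fin fvs.independent_empty by (metis empty_subsetI)
  have "card B = d + 1" using B S two_le_card_field[where 'a = 'a]
    by (metis One_nat_def Suc_1 Suc_le_lessD power_inject_exp)
  then show "is_flat d S"
    using S B fvs.dim_span_eq_card_independent[of B] by (simp add: is_flat_def)
qed

lemma subspace_card_pos_imp_finite:
  "card S = CARD('a::{field,finite}) ^ k \<Longrightarrow> finite S"
  by (metis card.infinite power_not_zero finite_UNIV_card_ge_0 finite_class.finite_UNIV less_not_refl)

text \<open>All flags formed by a finite subspace and a subspace of it, with given cardinalities, are
  linearly equivalent. So a coloring may be transported along any identification of a flag with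
  a standard one.\<close>
lemma flag_isomorphism:
  fixes U W U' W' :: "'a::{field,finite} flat"
  assumes sub: "fvs.subspace U" "fvs.subspace W" "fvs.subspace U'" "fvs.subspace W'"
    and incl: "U \<subseteq> W" "U' \<subseteq> W'" and fin: "finite W" "finite W'"
    and card: "card U = card U'" "card W = card W'"
  obtains f where "flinear f" "f ` W = W'" "f ` U = U'" "inj_on f W"
proof -
  have q: "1 < CARD('a)" using two_le_card_field[where 'a = 'a] by simp
  have finU: "finite U" "finite U'" using fin incl finite_subset by blast+
  obtain B where B: "B \<subseteq> U" "fvs.independent B" "fvs.span B = U" "finite B" "card U = CARD('a) ^ card B"
    by (rule finite_subspace_basis[OF sub(1) finU(1) empty_subsetI fvs.independent_empty])
  obtain B' where B': "B' \<subseteq> U'" "fvs.independent B'" "fvs.span B' = U'" "finite B'" "card U' = CARD('a) ^ card B'"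
    by (rule finite_subspace_basis[OF sub(3) finU(2) empty_subsetI fvs.independent_empty])
  obtain C where C: "B \<subseteq> C" "fvs.independent C" "fvs.span C = W" "finite C" "card W = CARD('a) ^ card C"
    using finite_subspace_basis[OF sub(2) fin(1) _ B(2)] B(1) incl by (metis subset_trans)
  obtain C' where C': "B' \<subseteq> C'" "fvs.independent C'" "fvs.span C' = W'" "finite C'" "card W' = CARD('a) ^ card C'"
    using finite_subspace_basis[OF sub(4) fin(2) _ B'(2)] B'(1) incl by (metis subset_trans)
  have cB: "card B = card B'" and cC: "card C = card C'"
    using B B' C C' card q by (metis power_inject_exp)+
  obtain g where g: "bij_betw g B B'" using finite_same_card_bij[OF B(4) B'(4) cB] by blast
  have "card (C - B) = card (C' - B')"
    using C C' B B' cB cC by (simp add: card_Diff_subset)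
  then obtain h where h: "bij_betw h (C - B) (C' - B')"
    using finite_same_card_bij C(4) C'(4) by (metis finite_Diff)
  define k where "k = (\<lambda>x. if x \<in> B then g x else h x)"
  have kB: "k ` B = B'" using g by (auto simp: k_def bij_betw_def)
  have "k ` (C - B) = C' - B'" using h unfolding bij_betw_def k_def by auto
  then have kC: "k ` C = C'" using kB C(1) C'(1) by (metis Un_Diff_cancel Un_absorb1 image_Un)
  interpret P: vector_space_pair "fscale :: 'a \<Rightarrow> _" "fscale :: 'a \<Rightarrow> _"
    by (rule vector_space_pair_fscale)
  obtain f where f: "flinear f" "\<And>x. x \<in> C \<Longrightarrow> f x = k x"
    using P.linear_independent_extend[OF C(2)] by blast
  interpret f: Vector_Spaces.linear fscale fscale f by (rule f(1))
  have fC: "f ` C = C'" using f(2) kC by auto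
  have fB: "f ` B = B'" using f(2) kB C(1) by (metis image_cong subsetD)
  have fW: "f ` W = W'" using f.span_image[of C] fC C C' by simp
  have fU: "f ` U = U'" using f.span_image[of B] fB B B' by simp
  have "inj_on f W" using fW card fin by (simp add: eq_card_imp_inj_on)
  then show ?thesis using that f(1) fW fU by blast
qed

section \<open>Coordinate subspaces and lines\<close>

lemma card_supported_functions:
  assumes "finite A"
  shows "card {v :: nat \<Rightarrow> 'a::{field,finite}. \<forall>i. i \<notin> A \<longrightarrow> v i = 0} = CARD('a) ^ card A"
proof -
  have "bij_betw (\<lambda>v. restrict v A) {v :: nat \<Rightarrow> 'a. \<forall>i. i \<notin> A \<longrightarrow> v i = 0} (A \<rightarrow>\<^sub>E UNIV)"
    by (rule bij_betw_byWitness[where f' = "\<lambda>v i. if i \<in> A then v i else 0"])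
       (auto simp: fun_eq_iff PiE_def extensional_def)
  then show ?thesis
    using assms by (simp add: bij_betw_same_card card_PiE)
qed

lemma subspace_ambient: "fvs.subspace (ambient n)"
  by (auto simp: fvs.subspace_def ambient_def fscale_def)

lemma card_ambient: "card (ambient n :: 'a::{field,finite} flat) = CARD('a) ^ (n + 1)"
proof -
  have "ambient n = {v :: nat \<Rightarrow> 'a. \<forall>i. i \<notin> {..n} \<longrightarrow> v i = 0}"
    by (auto simp: ambient_def)
  then show ?thesis using card_supported_functions[of "{..n}", where 'a = 'a] by simp
qed

lemma finite_ambient: "finite (ambient n :: 'a::{field,finite} flat)"
  using card_ambient subspace_card_pos_imp_finite by blast

lemma pg_subspaces_iff:
  fixes S :: "'a::{field,finite} flat"
  shows "S \<in> pg_subspaces n d \<longleftrightarrow>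
    fvs.subspace S \<and> card S = CARD('a) ^ (d + 1) \<and> S \<subseteq> ambient n"
  by (auto simp: pg_subspaces_def is_flat_iff_card)

lemma pg_lines_iff:
  fixes S :: "'a::{field,finite} flat"
  shows "S \<in> pg_lines n \<longleftrightarrow> fvs.subspace S \<and> card S = CARD('a) ^ 2 \<and> S \<subseteq> ambient n"
    and "S \<in> pg_subspaces n (Suc 0) \<longleftrightarrow> fvs.subspace S \<and> card S = CARD('a) ^ 2 \<and> S \<subseteq> ambient n"
  by (simp_all add: pg_subspaces_iff power2_eq_square)

lemma finite_pg_subspaces: "finite (pg_subspaces n d :: 'a::{field,finite} flat set)"
  by (rule finite_subset[of _ "Pow (ambient n)"]) (auto simp: pg_subspaces_def finite_ambient)

lemma card_span_singleton:
  fixes v :: "nat \<Rightarrow> 'a::{field,finite}"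
  shows "v \<noteq> 0 \<Longrightarrow> card (fvs.span {v}) = CARD('a)"
  using card_span_independent(1)[of "{v}"] by simp

lemma intersecting_iff:
  fixes S T :: "'a::{field,finite} flat"
  assumes "fvs.subspace S" "fvs.subspace T"
  shows "intersecting S T \<longleftrightarrow> (\<exists>v. v \<noteq> 0 \<and> v \<in> S \<and> v \<in> T)"
proof
  assume "intersecting S T"
  then obtain p where p: "card p = CARD('a)" "p \<subseteq> S" "p \<subseteq> T"
    by (auto simp: intersecting_def is_flat_iff_card)
  have "\<not> p \<subseteq> {0}"
    using p(1) two_le_card_field[where 'a = 'a] card_mono[of "{0}" p] by auto
  then show "\<exists>v. v \<noteq> 0 \<and> v \<in> S \<and> v \<in> T" using p by blast
next
  assume "\<exists>v. v \<noteq> 0 \<and> v \<in> S \<and> v \<in> T"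
  then obtain v where v: "v \<noteq> 0" "v \<in> S" "v \<in> T" by blast
  have "is_flat 0 (fvs.span {v})" using v by (simp add: is_flat_iff_card card_span_singleton)
  moreover have "fvs.span {v} \<subseteq> S" "fvs.span {v} \<subseteq> T"
    using v assms by (simp_all add: fvs.span_minimal)
  ultimately show "intersecting S T" unfolding intersecting_def by blast
qed

lemma line_coloringD:
  assumes "line_coloring L c f" "l \<in> L"
  shows "f l < c" "m \<in> L \<Longrightarrow> f l = f m \<Longrightarrow> intersecting l m \<Longrightarrow> l = m"
  using assms unfolding line_coloring_def by blast+

definition plane :: "(nat \<Rightarrow> 'a::field) \<Rightarrow> (nat \<Rightarrow> 'a) \<Rightarrow> 'a flat" where
  "plane v w = range (\<lambda>(s, t). fscale s v + fscale t w)"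

definition indep2 :: "(nat \<Rightarrow> 'a::field) \<Rightarrow> (nat \<Rightarrow> 'a) \<Rightarrow> bool" where
  "indep2 v w \<longleftrightarrow> (\<forall>s t. fscale s v + fscale t w = 0 \<longrightarrow> s = 0 \<and> t = 0)"

lemma indep2_unique:
  assumes "indep2 v w" "fscale s v + fscale t w = fscale s' v + fscale t' w"
  shows "s = s' \<and> t = t'"
proof -
  have "fscale (s - s') v + fscale (t - t') w = 0"
    using assms(2) by (simp add: fvs.scale_left_diff_distrib algebra_simps)
  then show ?thesis using assms(1) unfolding indep2_def by fastforce
qed

lemma plane_subset: "fvs.subspace l \<Longrightarrow> v \<in> l \<Longrightarrow> w \<in> l \<Longrightarrow> plane v w \<subseteq> l"
  by (auto simp: plane_def fvs.subspace_add fvs.subspace_scale)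

lemma card_plane:
  fixes v w :: "nat \<Rightarrow> 'a::{field,finite}"
  assumes "indep2 v w" shows "card (plane v w) = CARD('a) ^ 2"
proof -
  have "inj (\<lambda>(s, t). fscale s v + fscale t w)"
    using indep2_unique[OF assms] by (auto simp: inj_def)
  then show ?thesis by (simp add: plane_def card_image card_cartesian_product power2_eq_square
    flip: UNIV_Times_UNIV)
qed

lemma line_eq_plane:
  fixes l :: "'a::{field,finite} flat"
  assumes "fvs.subspace l" "card l = CARD('a) ^ 2" "v \<in> l" "w \<in> l" "indep2 v w"
  shows "l = plane v w"
  using assms card_plane[OF assms(5)] plane_subset[OF assms(1,3,4)]
  by (metis card_subset_eq subspace_card_pos_imp_finite)

lemma line_second_vector:
  fixes l :: "'a::{field,finite} flat"
  assumes "fvs.subspace l" "card l = CARD('a) ^ 2" "v \<in> l" "v \<noteq> 0"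
  obtains w where "w \<in> l" "indep2 v w" "l = plane v w"
proof -
  have "card (fvs.span {v}) < card l"
    using two_le_card_field[where 'a = 'a] assms by (simp add: card_span_singleton power2_eq_square)
  then obtain w where w: "w \<in> l" "w \<notin> fvs.span {v}"
    by (metis card_mono not_less subsetI subspace_card_pos_imp_finite assms(2) card_span_singleton assms(4) power_one_right)
  have "indep2 v w"
    unfolding indep2_def
  proof (intro allI impI)
    fix s t assume e: "fscale s v + fscale t w = 0"
    have "t = 0"
    proof (rule ccontr)
      assume t: "t \<noteq> 0"
      from e have "fscale t w = fscale (- s) v" by (simp add: eq_neg_iff_add_eq_0 add.commute)
      then have "fscale (inverse t) (fscale t w) = fscale (inverse t) (fscale (- s) v)" by simp
      then have "w = fscale (inverse t * - s) v" using t by simp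
      then show False using w(2) by (metis fvs.span_singleton rangeI)
    qed
    with e assms(4) show "s = 0 \<and> t = 0" by (simp add: fscale_eq_0_iff)
  qed
  then show ?thesis using that w line_eq_plane assms by blast
qed

lemma line_basis:
  fixes l :: "'a::{field,finite} flat"
  assumes "fvs.subspace l" "card l = CARD('a) ^ 2"
  obtains v w where "v \<in> l" "w \<in> l" "indep2 v w" "l = plane v w"
proof -
  have "\<not> l \<subseteq> {0}"
    using assms(2) two_le_card_field[where 'a = 'a] card_mono[of "{0}" l] power_mono[of 2 "CARD('a)" 2]
    by auto
  then obtain v where "v \<in> l" "v \<noteq> 0" by blast
  then show ?thesis using line_second_vector[OF assms] that by metis
qed

lemma flinear_image_subspace:
  "flinear f \<Longrightarrow> fvs.subspace S \<Longrightarrow> fvs.subspace (f ` S)"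
  using Vector_Spaces.linear.axioms(3) module_hom.subspace_image by blast

section \<open>Lower bounds\<close>

text \<open>The lines through \<open>v\<close> partition the vectors outside the span of \<open>v\<close>.\<close>
lemma card_lines_through_point:
  fixes v :: "nat \<Rightarrow> 'a::{field,finite}"
  assumes v: "v \<in> ambient n" "v \<noteq> 0"
  shows "card {l \<in> pg_lines n. v \<in> l} * (CARD('a) - 1) = CARD('a) ^ n - 1"
proof -
  let ?q = "CARD('a)" and ?L = "{l \<in> pg_lines n. v \<in> l}" and ?p = "fvs.span {v}"
  have q: "2 \<le> ?q" by (rule two_le_card_field)
  have sub: "?p \<subseteq> l" if "l \<in> ?L" for l
    using that fvs.span_minimal[of "{v}" l] by (auto simp: pg_lines_iff)
  have cp: "card ?p = ?q" "finite ?p" using card_span_singleton[OF v(2)] card_span_independent(2)[of "{v}"] v by simp_all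
  have cl: "card (l - ?p) = ?q * (?q - 1)" if "l \<in> ?L" for l
    using sub[OF that] that cp by (simp add: card_Diff_subset pg_lines_iff power2_eq_square diff_mult_distrib2)
  have un: "(\<Union>l\<in>?L. l - ?p) = ambient n - ?p"
  proof (intro equalityI subsetI)
    fix w assume w: "w \<in> ambient n - ?p"
    have ind: "fvs.independent {w, v}"
      using w v by (simp add: fvs.independent_insert)
    have ne: "w \<noteq> v" using w by (auto intro: fvs.span_base)
    have "card (fvs.span {w, v}) = ?q ^ 2"
      using card_span_independent(1)[OF _ ind] ne by (simp add: power2_eq_square)
    moreover have "fvs.span {w, v} \<subseteq> ambient n"
      using w v subspace_ambient by (intro fvs.span_minimal) auto
    ultimately have "fvs.span {w, v} \<in> ?L" by (simp add: pg_lines_iff fvs.span_base power2_eq_square)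
    then show "w \<in> (\<Union>l\<in>?L. l - ?p)" using w fvs.span_base[of w "{w, v}"] by blast
  qed (auto simp: pg_lines_iff)
  have disj: "(l - ?p) \<inter> (m - ?p) = {}" if lm: "l \<in> ?L" "m \<in> ?L" "l \<noteq> m" for l m
  proof (rule ccontr)
    assume "(l - ?p) \<inter> (m - ?p) \<noteq> {}"
    then obtain w where w: "w \<in> l" "w \<in> m" "w \<notin> ?p" by blast
    have ind: "fvs.independent {w, v}" using w v by (simp add: fvs.independent_insert)
    have ne: "w \<noteq> v" using w by (auto intro: fvs.span_base)
    have c2: "card (fvs.span {w, v}) = ?q ^ 2"
      using card_span_independent(1)[OF _ ind] ne by (simp add: power2_eq_square)
    have "fvs.span {w, v} = k" if k: "k \<in> ?L" "w \<in> k" for k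
    proof (rule card_subset_eq)
      show "finite k" using k finite_ambient finite_subset by (auto simp: pg_lines_iff)
      show "fvs.span {w, v} \<subseteq> k" using k by (intro fvs.span_minimal) (auto simp: pg_lines_iff)
      show "card (fvs.span {w, v}) = card k" using k c2 by (simp add: pg_lines_iff)
    qed
    then show False using lm w by metis
  qed
  have "card (ambient n - ?p) = card (\<Union>l\<in>?L. l - ?p)" by (simp only: un)
  also have "\<dots> = (\<Sum>l\<in>?L. card (l - ?p))"
  proof (rule card_UN_disjoint)
    show "finite ?L" by (simp add: finite_pg_subspaces)
    show "\<forall>l\<in>?L. finite (l - ?p)" using finite_ambient finite_subset by (auto simp: pg_lines_iff)
  qed (use disj in blast)
  also have "\<dots> = card ?L * (?q * (?q - 1))" using cl by simp
  finally have *: "card (ambient n - ?p) = card ?L * (?q * (?q - 1))" .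
  have "?p \<subseteq> ambient n" using v subspace_ambient by (intro fvs.span_minimal) auto
  then have "card (ambient n - ?p) = ?q ^ (n + 1) - ?q"
    using cp by (simp add: card_Diff_subset card_ambient)
  also have "\<dots> = ?q * (?q ^ n - 1)" by (simp add: diff_mult_distrib2)
  finally have "?q * (?q ^ n - 1) = ?q * (card ?L * (?q - 1))" using * by (simp add: mult_ac)
  then show ?thesis using q by simp
qed

text \<open>Double counting of incident pairs of a nonzero vector and a line: within one color class the
  line is determined by the vector, so a class contributes at most the number of vectors that it
  covers.\<close>
lemma coloring_incidence_bound:
  fixes f :: "'a::{field,finite} flat \<Rightarrow> nat"
  assumes f: "line_coloring (pg_lines n) c f"
    and M: "\<And>\<L> :: 'a flat set. \<L> \<subseteq> pg_lines n \<Longrightarrow> (\<And>l m. l \<in> \<L> \<Longrightarrow> m \<in> \<L> \<Longrightarrow> l \<noteq> m \<Longrightarrow> \<not> intersecting l m)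
      \<Longrightarrow> card (\<Union>\<L> - {0}) \<le> M"
  shows "(CARD('a) ^ (n + 1) - 1) * ((CARD('a) ^ n - 1) div (CARD('a) - 1)) \<le> c * M"
proof -
  let ?q = "CARD('a)" and ?V = "ambient n :: 'a flat" and ?L = "pg_lines n :: 'a flat set"
  define D where "D = (SIGMA v:?V - {0}. {l \<in> ?L. v \<in> l})"
  define E where "E i = {(v, l). (v, l) \<in> D \<and> f l = i}" for i
  have finD: "finite D" unfolding D_def
    by (intro finite_SigmaI) (auto simp: finite_ambient finite_pg_subspaces)
  have q: "2 \<le> ?q" by (rule two_le_card_field)
  have thr: "card {l \<in> ?L. v \<in> l} = (?q ^ n - 1) div (?q - 1)" if "v \<in> ?V - {0}" for v
  proof -
    have "card {l \<in> ?L. v \<in> l} * (?q - 1) = ?q ^ n - 1"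
      using that by (intro card_lines_through_point) auto
    moreover have "?q - 1 \<noteq> 0" using q by simp
    ultimately show ?thesis by (metis nonzero_mult_div_cancel_right)
  qed
  have cD: "card D = (?q ^ (n + 1) - 1) * ((?q ^ n - 1) div (?q - 1))"
  proof -
    have "card D = (\<Sum>v\<in>?V - {0}. card {l \<in> ?L. v \<in> l})"
      unfolding D_def by (rule card_SigmaI) (auto simp: finite_ambient finite_pg_subspaces)
    also have "\<dots> = card (?V - {0}) * ((?q ^ n - 1) div (?q - 1))" using thr by simp
    finally show ?thesis
      using card_ambient[of n, where 'a = 'a] fvs.subspace_0[OF subspace_ambient[of n, where 'a = 'a]]
      by (simp add: card_Diff_singleton)
  qed
  have cE: "card (E i) \<le> M" for i
  proof -
    let ?C = "{l \<in> ?L. f l = i}"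
    have disj: "\<not> intersecting l m" if "l \<in> ?C" "m \<in> ?C" "l \<noteq> m" for l m
    proof
      assume "intersecting l m"
      then show False using line_coloringD(2)[OF f, of l m] that by auto
    qed
    have "inj_on fst (E i)"
    proof (rule inj_onI)
      fix x y assume e: "x \<in> E i" "y \<in> E i" "fst x = fst y"
      obtain v l m where xy: "x = (v, l)" "y = (v, m)" using e(3) by (cases x, cases y) auto
      have v: "v \<noteq> 0" "v \<in> l" "v \<in> m" "l \<in> ?C" "m \<in> ?C" using e xy by (auto simp: E_def D_def)
      then have "intersecting l m"
        using intersecting_iff[of l m] by (auto simp: pg_lines_iff)
      then have "l = m" using disj[OF v(4,5)] by blast
      then show "x = y" using xy by simp
    qed
    then have "card (E i) = card (fst ` E i)" by (simp add: card_image)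
    also have "\<dots> \<le> card (\<Union>?C - {0})"
    proof (rule card_mono)
      have "\<Union>?C \<subseteq> ?V" by (auto simp: pg_lines_iff)
      then show "finite (\<Union>?C - {0})" using finite_ambient finite_subset by blast
    qed (auto simp: E_def D_def)
    also have "\<dots> \<le> M"
    proof (rule M)
      show "\<not> intersecting l m" if "l \<in> ?C" "m \<in> ?C" "l \<noteq> m" for l m
        using disj[OF that] .
    qed blast
    finally show ?thesis .
  qed
  have "D = (\<Union>i<c. E i)" using f by (auto simp: E_def D_def line_coloring_def)
  then have "card D \<le> (\<Sum>i<c. card (E i))" by (simp add: card_UN_le)
  also have "\<dots> \<le> c * M" using sum_bounded_above[of "{..<c}" "\<lambda>i. card (E i)" M] cE by simp
  finally show ?thesis using cD by simp
qed

lemma chromatic_lower_bound: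
  fixes f :: "'a::{field,finite} flat \<Rightarrow> nat"
  assumes f: "line_coloring (pg_lines n) c f"
  shows "(CARD('a) ^ n - 1) div (CARD('a) - 1) \<le> c"
proof -
  let ?q = "CARD('a)"
  have q: "2 \<le> ?q" by (rule two_le_card_field)
  have z: "(0 :: nat \<Rightarrow> 'a) \<in> ambient n" using subspace_ambient by (rule fvs.subspace_0)
  have "card (\<Union>\<L> - {0}) \<le> ?q ^ (n + 1) - 1" if "\<L> \<subseteq> pg_lines n" for \<L> :: "'a flat set"
  proof -
    have "card (\<Union>\<L> - {0}) \<le> card (ambient n - {0} :: 'a flat)"
    proof (rule card_mono)
      have "l \<subseteq> ambient n" if "l \<in> \<L>" for l
        using subsetD[OF \<open>\<L> \<subseteq> pg_lines n\<close> that] by (simp add: pg_lines_iff)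
      then show "\<Union>\<L> - {0} \<subseteq> ambient n - {0}" by blast
    qed (simp add: finite_ambient)
    then show ?thesis using z card_ambient[of n, where 'a = 'a] by (simp add: card_Diff_singleton)
  qed
  then have "(?q ^ (n + 1) - 1) * ((?q ^ n - 1) div (?q - 1)) \<le> c * (?q ^ (n + 1) - 1)"
    using coloring_incidence_bound[OF f] by blast
  moreover have "1 < ?q ^ (n + 1)" using q by (intro one_less_power) auto
  ultimately show ?thesis by (simp add: mult.commute)
qed

definition dot :: "nat \<Rightarrow> (nat \<Rightarrow> 'a::field) \<Rightarrow> (nat \<Rightarrow> 'a) \<Rightarrow> 'a" where
  "dot n w v = (\<Sum>i\<le>n. w i * v i)"

lemma dot_linear:
  "dot n w (v + v') = dot n w v + dot n w v'" "dot n w (v - v') = dot n w v - dot n w v'"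
  "dot n w (fscale c v) = c * dot n w v" "dot n w v = dot n v w" "dot n w 0 = 0" "dot n 0 w = 0"
  by (simp_all add: dot_def fscale_def algebra_simps sum.distrib sum_subtractf sum_distrib_left)

lemma card_kernel_dot_on:
  fixes S :: "'a::{field,finite} flat"
  assumes S: "fvs.subspace S" "finite S"
  shows "card {v \<in> S. dot n w v = 0} = card S \<or> CARD('a) * card {v \<in> S. dot n w v = 0} = card S"
proof (cases "\<forall>v\<in>S. dot n w v = 0")
  case True
  then have "{v \<in> S. dot n w v = 0} = S" by auto
  then show ?thesis by simp
next
  case False
  then obtain v where v: "v \<in> S" "dot n w v \<noteq> 0" by blast
  have "a \<in> dot n w ` S" for a
    using v S by (intro image_eqI[where x = "fscale (a / dot n w v) v"]) (auto simp: dot_linear fvs.subspace_scale)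
  then have im: "dot n w ` S = UNIV" by auto
  have "card S = card (dot n w ` S) * card {v \<in> S. dot n w v = 0}"
    by (rule card_eq_image_times_kernel)
       (use S in \<open>auto simp: dot_linear fvs.subspace_add fvs.subspace_diff\<close>)
  then show ?thesis using im by simp
qed

lemma card_hyperplane:
  fixes w :: "nat \<Rightarrow> 'a::{field,finite}"
  assumes w: "w \<in> ambient n" "w \<noteq> 0"
  shows "card {v \<in> ambient n. dot n w v = 0} = CARD('a) ^ n"
proof -
  obtain i where i: "w i \<noteq> 0" using w(2) by (auto simp: fun_eq_iff)
  then have "i \<le> n" using w(1) by (auto simp: ambient_def not_less[symmetric])
  define e :: "nat \<Rightarrow> 'a" where "e = (\<lambda>j. if j = i then 1 else 0)"
  have e: "e \<in> ambient n" using \<open>i \<le> n\<close> by (auto simp: e_def ambient_def)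
  have "dot n w e = w i" using \<open>i \<le> n\<close> by (simp add: dot_def e_def if_distrib sum.delta cong: if_cong)
  then have "e \<in> ambient n - {v \<in> ambient n. dot n w v = 0}" using i e by simp
  then have "{v \<in> ambient n. dot n w v = 0} \<subset> ambient n" by blast
  then have "card {v \<in> ambient n. dot n w v = 0} < card (ambient n :: 'a flat)"
    by (rule psubset_card_mono[OF finite_ambient])
  then show ?thesis
    using card_kernel_dot_on[OF subspace_ambient finite_ambient, of n n w] two_le_card_field[where 'a = 'a]
    by (simp add: card_ambient)
qed

text \<open>The congruences behind the bound on partial spreads with \<open>s\<close> lines, \<open>a w\<close> of them in the
  hyperplane \<open>w\<close>, and with \<open>h\<close> points not covered, \<open>g w\<close> of them in the hyperplane \<open>w\<close>: if \<open>h\<close> were below \<open>q\<^sup>2\<close>, then \<open>h = 1 + (q + 1) * k\<close> with \<open>k \<le> q - 2\<close>, and every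
  hyperplane would contain at least \<open>k + 1\<close> holes, more than the average allows.\<close>
lemma hole_arithmetic:
  fixes q h s :: int and g a :: "'w \<Rightarrow> int"
  assumes q: "2 \<le> q" and n: "even n" "0 < n"
    and h: "(q - 1) * h = q ^ (n + 1) - 1 - s * (q ^ 2 - 1)" "0 \<le> h"
    and g: "\<And>w. w \<in> W \<Longrightarrow> (q - 1) * g w = q ^ n - 1 - a w * (q ^ 2 - 1) - (s - a w) * (q - 1)"
      "\<And>w. w \<in> W \<Longrightarrow> 0 \<le> g w"
    and W: "finite W" "int (card W) = q ^ (n + 1) - 1"
    and total: "(\<Sum>w\<in>W. g w) = h * (q ^ n - 1)"
  shows "q ^ 2 \<le> h"
proof (rule ccontr)
  assume "\<not> q ^ 2 \<le> h"
  then have small: "h < q ^ 2" by simp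
  obtain m where m: "n = 2 * m" using n by (auto elim: evenE)
  have "q ^ 2 - 1 dvd (q ^ 2) ^ m - 1 ^ m" by (metis dvd_triv_left power_diff_sumr2)
  then obtain t where t: "q ^ n - 1 = (q ^ 2 - 1) * t" by (auto simp: m power_mult elim: dvdE)
  have "q dvd q ^ n" using n by (simp add: dvd_power)
  then obtain r where r: "q ^ n = q * r" by (elim dvdE)
  define t' where "t' = q * t - r"
  have t': "t = 1 + q * t'" using t unfolding t'_def r by (simp add: algebra_simps power2_eq_square)
  define k where "k = q * t - s"
  have "(q - 1) * h = (q - 1) * (1 + (q + 1) * k)"
  proof -
    have "q ^ (n + 1) = q * ((q ^ 2 - 1) * t + 1)" using t by simp
    then show ?thesis unfolding h(1) k_def by (simp add: algebra_simps power2_eq_square)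
  qed
  then have hk: "h = 1 + (q + 1) * k" using q by simp
  have k0: "0 \<le> k"
  proof (rule ccontr)
    assume "\<not> 0 \<le> k"
    then have "(q + 1) * k \<le> (q + 1) * (-1)" using q by (intro mult_left_mono) auto
    then show False using hk h(2) q by simp
  qed
  have "(q + 1) * k < (q + 1) * (q - 1)" using small hk by (simp add: algebra_simps power2_eq_square)
  then have k1: "k < q - 1" using q by simp
  have gw: "k + 1 \<le> g w" if w: "w \<in> W" for w
  proof -
    have "(q - 1) * g w = (q - 1) * (k + 1 + q * (t' - a w))"
    proof -
      have "q * t' = t - 1" using t' by simp
      then have "k + 1 + q * (t' - a w) = k + t - q * a w" by (simp add: algebra_simps)
      moreover have "(q - 1) * g w = (q - 1) * (k + t - q * a w)"
        unfolding g(1)[OF w] t k_def by (simp add: algebra_simps power2_eq_square)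
      ultimately show ?thesis by metis
    qed
    then have gk: "g w = k + 1 + q * (t' - a w)" using q by simp
    have "0 \<le> t' - a w"
    proof (rule ccontr)
      assume "\<not> 0 \<le> t' - a w"
      then have "q * (t' - a w) \<le> q * (-1)" using q by (intro mult_left_mono) auto
      then show False using gk g(2)[OF w] k1 by simp
    qed
    then show ?thesis using gk q by simp
  qed
  have "(q ^ (n + 1) - 1) * (k + 1) \<le> h * (q ^ n - 1)"
    using sum_bounded_below[of W "k + 1" g] gw total W by simp
  also have "\<dots> \<le> (q * (k + 1)) * (q ^ n - 1)"
    using k1 k0 hk q by (intro mult_right_mono) (auto simp: algebra_simps)
  also have "\<dots> = (q ^ (n + 1) - q) * (k + 1)" by (simp add: algebra_simps)
  finally have "(q ^ (n + 1) - 1) * (k + 1) \<le> (q ^ (n + 1) - q) * (k + 1)" .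
  then show False using k0 q by (simp add: mult_le_cancel_right)
qed

text \<open>A partial line spread in even projective dimension misses at least \<open>q\<^sup>2\<close> points. The holes are
  counted in the hyperplanes: a line has \<open>q\<^sup>2\<close> or \<open>q\<close> vectors in common with a hyperplane, so the
  number of holes in a hyperplane is determined modulo \<open>q\<close>.\<close>
lemma partial_spread_holes:
  fixes \<L> :: "'a::{field,finite} flat set"
  assumes n: "even n" "0 < n"
    and L: "\<L> \<subseteq> pg_lines n" and disj: "\<And>l m. l \<in> \<L> \<Longrightarrow> m \<in> \<L> \<Longrightarrow> l \<noteq> m \<Longrightarrow> \<not> intersecting l m"
  shows "card (\<Union>\<L> - {0}) + CARD('a) ^ 2 * (CARD('a) - 1) \<le> CARD('a) ^ (n + 1) - 1"
proof -
  let ?q = "CARD('a)" and ?V = "ambient n :: 'a flat"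
  define K where "K w = {v \<in> ?V. dot n w v = 0}" for w
  define H where "H = ?V - {0} - \<Union>\<L>"
  define s where "s = card \<L>"
  define a where "a w = card {l \<in> \<L>. l \<subseteq> K w}" for w
  define W where "W = ?V - {0}"
  have q: "2 \<le> ?q" by (rule two_le_card_field)
  have z: "0 \<in> ?V" using subspace_ambient by (rule fvs.subspace_0)
  have finL: "finite \<L>" using L finite_pg_subspaces finite_subset by blast
  have line: "fvs.subspace l" "card l = ?q ^ 2" "l \<subseteq> ?V" "finite l" "0 \<in> l" if "l \<in> \<L>" for l
    using subsetD[OF L that] finite_subset[OF _ finite_ambient, of l n] fvs.subspace_0[of l]
    by (simp_all add: pg_lines_iff)
  have disj0: "(l - {0}) \<inter> (m - {0}) = {}" if "l \<in> \<L>" "m \<in> \<L>" "l \<noteq> m" for l m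
    using disj[OF that] intersecting_iff[of l m] line that by blast
  have cov: "card ((\<Union>\<L> - {0}) \<inter> T) = (\<Sum>l\<in>\<L>. card (l \<inter> T) - 1)" if "0 \<in> T" for T
  proof -
    have "(\<Union>\<L> - {0}) \<inter> T = (\<Union>l\<in>\<L>. l \<inter> T - {0})" by auto
    also have "card \<dots> = (\<Sum>l\<in>\<L>. card (l \<inter> T - {0}))"
    proof (rule card_UN_disjoint)
      show "\<forall>l\<in>\<L>. \<forall>m\<in>\<L>. l \<noteq> m \<longrightarrow> (l \<inter> T - {0}) \<inter> (m \<inter> T - {0}) = {}"
        using disj0 by blast
    qed (use finL line in auto)
    also have "\<dots> = (\<Sum>l\<in>\<L>. card (l \<inter> T) - 1)"
      by (rule sum.cong) (use line that in \<open>auto simp: card_Diff_singleton\<close>)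
    finally show ?thesis .
  qed
  have covV: "card (\<Union>\<L> - {0}) = s * (?q ^ 2 - 1)"
    using cov[of UNIV] line by (simp add: s_def)
  have LV: "\<Union>\<L> \<subseteq> ?V" using line by blast
  have cW: "card W = ?q ^ (n + 1) - 1"
    using z card_ambient[of n, where 'a = 'a] by (simp add: W_def card_Diff_singleton)
  have cH: "int (card H) = int ?q ^ (n + 1) - 1 - int s * (int ?q ^ 2 - 1)"
    and le: "card (\<Union>\<L> - {0}) + card H = ?q ^ (n + 1) - 1"
  proof -
    have "W = (\<Union>\<L> - {0}) \<union> H" "(\<Union>\<L> - {0}) \<inter> H = {}" using LV by (auto simp: W_def H_def)
    then have "card W = card (\<Union>\<L> - {0}) + card H"
      using finite_ambient by (metis card_Un_disjoint finite_Diff finite_Un W_def)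
    then show *: "card (\<Union>\<L> - {0}) + card H = ?q ^ (n + 1) - 1" using cW by simp
    have "int (s * (?q ^ 2 - 1)) + int (card H) = int (?q ^ (n + 1) - 1)"
      using * unfolding covV by (metis of_nat_add)
    then show "int (card H) = int ?q ^ (n + 1) - 1 - int s * (int ?q ^ 2 - 1)"
      using q by (simp add: of_nat_diff)
  qed
  have cK: "card (K w) = ?q ^ n" if "w \<in> W" for w
    using card_hyperplane[of w n] that by (simp add: K_def W_def)
  have lK: "int (card (l \<inter> K w) - 1) = (if l \<subseteq> K w then int ?q ^ 2 - 1 else int ?q - 1)" if "l \<in> \<L>" for l w
  proof -
    have lk: "l \<inter> K w = {v \<in> l. dot n w v = 0}" using line(3)[OF that] by (auto simp: K_def)
    show ?thesis
    proof (cases "l \<subseteq> K w")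
      case True
      then have "l \<inter> K w = l" by blast
      then show ?thesis using True q line[OF that] by (simp add: of_nat_diff)
    next
      case False
      then have "l \<inter> K w \<subset> l" by blast
      then have "card (l \<inter> K w) < card l" by (rule psubset_card_mono[OF line(4)[OF that]])
      then have "?q * card (l \<inter> K w) = ?q * ?q"
        using card_kernel_dot_on[of l n w] line[OF that] lk by (auto simp: power2_eq_square)
      then show ?thesis using False q by (simp add: of_nat_diff)
    qed
  qed
  have cHK: "int (card (H \<inter> K w)) = int ?q ^ n - 1 - int (a w) * (int ?q ^ 2 - 1) - (int s - int (a w)) * (int ?q - 1)"
    if w: "w \<in> W" for w
  proof -
    have zK: "0 \<in> K w" using z by (simp add: K_def dot_linear)
    have finK: "finite (K w)" by (simp add: K_def finite_ambient)
    have "K w - {0} = ((\<Union>\<L> - {0}) \<inter> K w) \<union> (H \<inter> K w)" "((\<Union>\<L> - {0}) \<inter> K w) \<inter> (H \<inter> K w) = {}"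
      by (auto simp: H_def K_def)
    then have "card (K w - {0}) = card ((\<Union>\<L> - {0}) \<inter> K w) + card (H \<inter> K w)"
      using finK by (metis card_Un_disjoint finite_Diff finite_Un)
    then have "int (card (K w) - 1) = int (card ((\<Union>\<L> - {0}) \<inter> K w)) + int (card (H \<inter> K w))"
      using zK finK by (simp add: card_Diff_singleton)
    moreover have "int (card ((\<Union>\<L> - {0}) \<inter> K w)) = (\<Sum>l\<in>\<L>. if l \<subseteq> K w then int ?q ^ 2 - 1 else int ?q - 1)"
      unfolding cov[OF zK] of_nat_sum by (rule sum.cong) (use lK in auto)
    moreover have "\<dots> = int (a w) * (int ?q ^ 2 - 1) + (int s - int (a w)) * (int ?q - 1)"
    proof -
      have "card {l \<in> \<L>. \<not> l \<subseteq> K w} = s - a w" "a w \<le> s"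
      proof -
        have "{l \<in> \<L>. \<not> l \<subseteq> K w} = \<L> - {l \<in> \<L>. l \<subseteq> K w}" by blast
        then show "card {l \<in> \<L>. \<not> l \<subseteq> K w} = s - a w"
          using finL by (simp add: s_def a_def card_Diff_subset)
        show "a w \<le> s" unfolding a_def s_def by (rule card_mono) (use finL in auto)
      qed
      moreover have "\<L> \<inter> {l. l \<subseteq> K w} = {l \<in> \<L>. l \<subseteq> K w}"
        "\<L> \<inter> - {l. l \<subseteq> K w} = {l \<in> \<L>. \<not> l \<subseteq> K w}" by auto
      ultimately show ?thesis
        using finL by (simp add: sum.If_cases a_def[symmetric] of_nat_diff)
    qed
    moreover have "int (card (K w) - 1) = int ?q ^ n - 1" using cK[OF w] q by (simp add: of_nat_diff)
    ultimately show ?thesis by linarith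
  qed
  have finH: "finite H" by (simp add: H_def finite_ambient)
  have "(\<Sum>w\<in>W. card (H \<inter> K w)) = (\<Sum>v\<in>H. card {w \<in> W. v \<in> K w})"
  proof -
    have "(\<Sum>w\<in>W. card (H \<inter> K w)) = (\<Sum>w\<in>W. \<Sum>v\<in>H. if v \<in> K w then 1 else 0)"
      using finH by (simp add: sum.If_cases Int_def)
    also have "\<dots> = (\<Sum>v\<in>H. \<Sum>w\<in>W. if v \<in> K w then 1 else 0)" by (rule sum.swap)
    also have "\<dots> = (\<Sum>v\<in>H. card {w \<in> W. v \<in> K w})"
      by (simp add: finite_ambient W_def sum.If_cases Int_def)
    finally show ?thesis .
  qed
  also have "\<dots> = (\<Sum>v\<in>H. ?q ^ n - 1)"
  proof (rule sum.cong[OF refl])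
    fix v assume v: "v \<in> H"
    have "{w \<in> W. v \<in> K w} = {w \<in> ?V. dot n v w = 0} - {0}"
      using v by (auto simp: W_def K_def H_def dot_linear(4)[of n v])
    moreover have "0 \<in> {w \<in> ?V. dot n v w = 0}" using z by (simp add: dot_linear)
    ultimately show "card {w \<in> W. v \<in> K w} = ?q ^ n - 1"
      using card_hyperplane[of v n] v by (simp add: H_def card_Diff_singleton)
  qed
  finally have tot: "(\<Sum>w\<in>W. int (card (H \<inter> K w))) = int (card H) * (int ?q ^ n - 1)"
  proof -
    assume "(\<Sum>w\<in>W. card (H \<inter> K w)) = (\<Sum>v\<in>H. ?q ^ n - 1)"
    then have "(\<Sum>w\<in>W. card (H \<inter> K w)) = card H * (?q ^ n - 1)" by simp
    then have "int (\<Sum>w\<in>W. card (H \<inter> K w)) = int (card H * (?q ^ n - 1))" by (simp only:)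
    then show ?thesis using q by (simp add: of_nat_diff)
  qed
  \<comment> \<open>pass from vectors to points\<close>
  have qn: "int ?q - 1 dvd int ?q ^ k - 1" for k
    by (metis dvd_triv_left power_diff_1_eq)
  have q2: "int ?q - 1 dvd int ?q ^ 2 - 1" by (rule qn)
  have dH: "int ?q - 1 dvd int (card H)" unfolding cH by (rule dvd_diff[OF qn dvd_mult[OF q2]])
  have dHK: "int ?q - 1 dvd int (card (H \<inter> K w))" if "w \<in> W" for w
    unfolding cHK[OF that] by (rule dvd_diff[OF dvd_diff[OF qn dvd_mult[OF q2]] dvd_mult[OF dvd_refl]])
  define h where "h = int (card H) div (int ?q - 1)"
  define g where "g w = int (card (H \<inter> K w)) div (int ?q - 1)" for w
  have h: "(int ?q - 1) * h = int (card H)" using dH by (simp add: h_def)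
  have g: "(int ?q - 1) * g w = int (card (H \<inter> K w))" if "w \<in> W" for w
    using dHK[OF that] by (simp add: g_def)
  have "int ?q ^ 2 \<le> h"
  proof (rule hole_arithmetic[of "int ?q" n h "int s" W g "\<lambda>w. int (a w)"])
    show "0 \<le> h" "\<And>w. 0 \<le> g w" using q by (auto simp: h_def g_def intro!: div_int_pos_iff[THEN iffD2])
    have "(int ?q - 1) * (\<Sum>w\<in>W. g w) = (\<Sum>w\<in>W. int (card (H \<inter> K w)))"
      unfolding sum_distrib_left by (rule sum.cong) (use g in auto)
    also have "\<dots> = (int ?q - 1) * (h * (int ?q ^ n - 1))" unfolding tot h[symmetric] by simp
    finally show "(\<Sum>w\<in>W. g w) = h * (int ?q ^ n - 1)" using q by simp
    show "int (card W) = int ?q ^ (n + 1) - 1" using cW q by (simp add: of_nat_diff)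
  qed (use q n h g cH cHK finite_ambient W_def in auto)
  then have "int ?q ^ 2 * (int ?q - 1) \<le> h * (int ?q - 1)"
    using q by (intro mult_right_mono) auto
  moreover have "int (?q ^ 2 * (?q - 1)) = int ?q ^ 2 * (int ?q - 1)" using q by (simp add: of_nat_diff)
  ultimately have "int (?q ^ 2 * (?q - 1)) \<le> int (card H)" using h by (simp add: mult.commute)
  then show ?thesis using le by linarith
qed

lemma dvd_power_minus_one: "(q - 1) dvd (q ^ n - (1::nat))"
proof (cases "q = 0")
  case False
  have "int q - 1 dvd int q ^ n - 1" by (metis dvd_triv_left power_diff_1_eq)
  then have "int (q - 1) dvd int (q ^ n - 1)" using False by (simp add: of_nat_diff Suc_le_eq)
  then show ?thesis by (simp only: int_dvd_int_iff)
qed (cases n; simp)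

text \<open>With \<open>N\<close> points and \<open>\<theta>\<close> lines through each, \<open>c\<close> colors satisfy \<open>N * \<theta> \<le> c * (N - q\<^sup>2)\<close>. As
  \<open>N = q * \<theta> + 1\<close>, inserting \<open>c = \<theta> + q\<close> leaves \<open>0 \<le> q - q\<^sup>3\<close>.\<close>
lemma chromatic_lower_bound_even:
  fixes f :: "'a::{field,finite} flat \<Rightarrow> nat"
  assumes n: "even n" "2 \<le> n" and f: "line_coloring (pg_lines n) c f"
  shows "(CARD('a) ^ n - 1) div (CARD('a) - 1) + CARD('a) + 1 \<le> c"
proof (rule ccontr)
  let ?q = "int CARD('a)"
  define \<theta> where "\<theta> = int ((CARD('a) ^ n - 1) div (CARD('a) - 1))"
  assume "\<not> ?thesis"
  then have c: "int c \<le> \<theta> + ?q" by (simp add: \<theta>_def)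
  have q: "2 \<le> CARD('a)" by (rule two_le_card_field)
  have "(CARD('a) - 1) dvd (CARD('a) ^ n - 1)" by (rule dvd_power_minus_one)
  then have "(CARD('a) - 1) * ((CARD('a) ^ n - 1) div (CARD('a) - 1)) = CARD('a) ^ n - 1" by simp
  then have "int (CARD('a) - 1) * \<theta> = int (CARD('a) ^ n - 1)"
    unfolding \<theta>_def by (metis of_nat_mult)
  then have \<theta>: "?q ^ n = (?q - 1) * \<theta> + 1" using q by (simp add: of_nat_diff)
  define M where "M = CARD('a) ^ (n + 1) - 1 - CARD('a) ^ 2 * (CARD('a) - 1)"
  have M: "card (\<Union>\<L> - {0}) \<le> M"
    if "\<L> \<subseteq> pg_lines n" "\<And>l m. l \<in> \<L> \<Longrightarrow> m \<in> \<L> \<Longrightarrow> l \<noteq> m \<Longrightarrow> \<not> intersecting l m"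
    for \<L> :: "'a flat set"
    using partial_spread_holes[OF n(1) _ that] n(2) by (simp add: M_def)
  have "CARD('a) ^ 2 * (CARD('a) - 1) \<le> CARD('a) ^ (n + 1) - 1"
    using partial_spread_holes[OF n(1), of "{} :: 'a flat set"] n(2) by simp
  then have "int M = int (CARD('a) ^ (n + 1) - 1) - int (CARD('a) ^ 2 * (CARD('a) - 1))"
    unfolding M_def by (rule of_nat_diff)
  then have iM: "int M = ?q ^ (n + 1) - 1 - ?q ^ 2 * (?q - 1)"
    using q by (simp add: of_nat_diff)
  have "int ((CARD('a) ^ (n + 1) - 1) * ((CARD('a) ^ n - 1) div (CARD('a) - 1))) \<le> int (c * M)"
    unfolding of_nat_le_iff by (rule coloring_incidence_bound[OF f]) (use M in blast)
  then have "(?q ^ (n + 1) - 1) * \<theta> \<le> int c * int M"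
    unfolding \<theta>_def using q by (simp add: of_nat_diff)
  also have "\<dots> \<le> (\<theta> + ?q) * int M" using c by (intro mult_right_mono) auto
  finally have "0 \<le> (\<theta> + ?q) * int M - (?q ^ (n + 1) - 1) * \<theta>" by simp
  also have "\<dots> = ?q * (?q - 1) * (1 - ?q ^ 2)"
  proof -
    have e: "?q ^ (n + 1) = ?q * ((?q - 1) * \<theta> + 1)" using \<theta> by simp
    show ?thesis unfolding iM e by (simp add: algebra_simps power2_eq_square)
  qed
  finally have "0 \<le> ?q * (?q - 1) * (1 - ?q ^ 2)" .
  moreover have "?q * (?q - 1) * (1 - ?q ^ 2) < 0"
    using q by (intro mult_pos_neg mult_pos_pos) (auto simp: power2_eq_square less_1_mult)
  ultimately show False by simp
qed

section \<open>Colorings, and colorings with a hole\<close>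

definition lines_of :: "'a::{field,finite} flat \<Rightarrow> 'a flat set" where
  "lines_of W = {l. fvs.subspace l \<and> card l = CARD('a) ^ 2 \<and> l \<subseteq> W}"

lemma pg_lines_eq_lines_of: "pg_lines n = lines_of (ambient n)"
  by (auto simp: lines_of_def pg_lines_iff)

text \<open>Properness without reference to a number of colors, so that structured color types can be used.\<close>
definition proper_on :: "'a::field flat set \<Rightarrow> ('a flat \<Rightarrow> 'c) \<Rightarrow> bool" where
  "proper_on L f \<longleftrightarrow> (\<forall>l\<in>L. \<forall>m\<in>L. f l = f m \<longrightarrow> (\<exists>v. v \<noteq> 0 \<and> v \<in> l \<and> v \<in> m) \<longrightarrow> l = m)"

lemma proper_onD:
  "proper_on L f \<Longrightarrow> l \<in> L \<Longrightarrow> m \<in> L \<Longrightarrow> f l = f m \<Longrightarrow> v \<noteq> 0 \<Longrightarrow> v \<in> l \<Longrightarrow> v \<in> m \<Longrightarrow> l = m"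
  unfolding proper_on_def by blast

lemma line_coloring_iff_proper_on:
  fixes L :: "'a::{field,finite} flat set"
  assumes "L \<subseteq> lines_of W"
  shows "line_coloring L c f \<longleftrightarrow> f ` L \<subseteq> {..<c} \<and> proper_on L f"
proof -
  have "intersecting l m \<longleftrightarrow> (\<exists>v. v \<noteq> 0 \<and> v \<in> l \<and> v \<in> m)" if "l \<in> L" "m \<in> L" for l m
  proof -
    have "fvs.subspace l" "fvs.subspace m" using assms that unfolding lines_of_def by blast+
    then show ?thesis by (rule intersecting_iff)
  qed
  then have "(l \<noteq> m \<and> intersecting l m \<longrightarrow> f l \<noteq> f m) \<longleftrightarrow>
      (f l = f m \<longrightarrow> (\<exists>v. v \<noteq> 0 \<and> v \<in> l \<and> v \<in> m) \<longrightarrow> l = m)" if "l \<in> L" "m \<in> L" for l m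
    using that by (cases "l = m"; cases "f l = f m") simp_all
  then have "(\<forall>l\<in>L. \<forall>m\<in>L. l \<noteq> m \<and> intersecting l m \<longrightarrow> f l \<noteq> f m) \<longleftrightarrow> proper_on L f"
    unfolding proper_on_def by (simp cong: ball_cong)
  then show ?thesis unfolding line_coloring_def by auto
qed

definition colorable :: "'a::field flat set \<Rightarrow> nat \<Rightarrow> bool" where
  "colorable L c \<longleftrightarrow> (\<exists>f. line_coloring L c f)"

text \<open>Besides being a coloring with \<open>c\<close> colors of the lines outside a subspace \<open>H\<close> of codimension two,
  this asks that the lines meeting \<open>H\<close> use initial colors only, as many as the number of lines outside
  \<open>H\<close> through a point of \<open>H\<close>. So each of these colors occurs on a line through every point of \<open>H\<close>, and
  every other color misses \<open>H\<close>.\<close>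
definition hole_colorable :: "'a::{field,finite} itself \<Rightarrow> nat \<Rightarrow> nat \<Rightarrow> bool" where
  "hole_colorable _ n c \<longleftrightarrow> (\<exists>H \<in> pg_subspaces n (n - 2) :: 'a flat set. \<exists>f.
     line_coloring (ipg_lines n H) c f \<and>
     (\<forall>l\<in>ipg_incident_lines n H. f l < CARD('a) ^ (n - 2) * (CARD('a) + 1)))"

text \<open>A set \<open>K\<close> of distinguished colors becomes an initial segment of the numbers.\<close>
lemma relabel_colors:
  assumes "finite C" "card C \<le> c" "K \<subseteq> C" "card K \<le> k"
  obtains h :: "'c \<Rightarrow> nat" where "inj_on h C" "h ` C \<subseteq> {..<c}" "h ` K \<subseteq> {..<k}"
proof -
  have fK: "finite K" using assms finite_subset by blast
  obtain g where g: "bij_betw g K {0..<card K}" using ex_bij_betw_finite_nat[OF fK] by blast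
  obtain g' where g': "bij_betw g' (C - K) {0..<card (C - K)}"
    using ex_bij_betw_finite_nat[of "C - K"] assms(1) by blast
  define h where "h x = (if x \<in> K then g x else card K + g' x)" for x
  have cd: "card (C - K) + card K = card C"
    using assms fK by (simp add: card_Diff_subset card_mono)
  have gK: "g x < card K" if "x \<in> K" for x using g that by (auto simp: bij_betw_def)
  have gC: "g' x < card (C - K)" if "x \<in> C" "x \<notin> K" for x using g' that by (auto simp: bij_betw_def)
  have "inj_on h C"
  proof (rule inj_onI)
    fix x y assume xy: "x \<in> C" "y \<in> C" "h x = h y"
    have "(x \<in> K) = (y \<in> K)"
      using xy(3) gK[of x] gK[of y] by (cases "x \<in> K"; cases "y \<in> K") (auto simp: h_def)
    then show "x = y"
      using xy inj_onD[OF bij_betw_imp_inj_on[OF g], of x y] inj_onD[OF bij_betw_imp_inj_on[OF g'], of x y]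
      by (cases "x \<in> K") (simp_all add: h_def)
  qed
  moreover have "h x < c" if "x \<in> C" for x
    using gK[of x] gC[of x] cd assms(2) that by (cases "x \<in> K") (simp_all add: h_def)
  then have "h ` C \<subseteq> {..<c}" by blast
  moreover have "h x < k" if "x \<in> K" for x
    using gK[of x] assms(4) that by (simp add: h_def)
  then have "h ` K \<subseteq> {..<k}" by blast
  ultimately show ?thesis by (rule that)
qed

lemma proper_on_relabel:
  assumes "proper_on L f" "inj_on h C" "f ` L \<subseteq> C"
  shows "proper_on L (\<lambda>l. h (f l))"
  unfolding proper_on_def
proof (intro ballI impI)
  fix l m assume l: "l \<in> L" "m \<in> L" "h (f l) = h (f m)" "\<exists>v. v \<noteq> 0 \<and> v \<in> l \<and> v \<in> m"
  then have "f l = f m" using inj_onD[OF assms(2) l(3)] assms(3) by blast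
  then show "l = m" using l proper_onD[OF assms(1)] by blast
qed

lemma proper_on_transport:
  fixes W W' :: "'a::{field,finite} flat"
  assumes \<phi>: "flinear \<phi>" "inj_on \<phi> W" "\<phi> ` W = W'" and W: "0 \<in> W"
    and L: "L \<subseteq> lines_of W" "\<And>l. l \<in> L \<Longrightarrow> \<phi> ` l \<in> L'"
    and f: "proper_on L' f"
  shows "proper_on L (\<lambda>l. f (\<phi> ` l))"
  unfolding proper_on_def
proof (intro ballI impI)
  fix l m assume l: "l \<in> L" "m \<in> L" "f (\<phi> ` l) = f (\<phi> ` m)" "\<exists>v. v \<noteq> 0 \<and> v \<in> l \<and> v \<in> m"
  then obtain v where v: "v \<noteq> 0" "v \<in> l" "v \<in> m" by blast
  have sub: "l \<subseteq> W" "m \<subseteq> W" using l L(1) by (auto simp: lines_of_def)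
  have "\<phi> v \<noteq> \<phi> 0" using \<phi>(2) v sub W by (metis inj_onD subsetD)
  then have "\<phi> v \<noteq> 0" by (simp add: flinear_simps(4)[OF \<phi>(1)])
  then have "\<phi> ` l = \<phi> ` m"
    using proper_onD[OF f L(2)[OF l(1)] L(2)[OF l(2)] l(3)] v by blast
  then show "l = m" using inj_on_image_eq_iff[OF \<phi>(2) sub] by blast
qed

lemma lines_of_image:
  assumes "flinear \<phi>" "inj_on \<phi> W" "l \<in> lines_of W"
  shows "\<phi> ` l \<in> lines_of (\<phi> ` W)"
  using assms flinear_image_subspace[of \<phi> l] card_image[OF inj_on_subset, of \<phi> W l]
  by (auto simp: lines_of_def)

lemma coloring_transport:
  fixes W :: "'a::{field,finite} flat"
  assumes W: "fvs.subspace W" "card W = CARD('a) ^ (n + 1)"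
    and f: "line_coloring (pg_lines n :: 'a flat set) c f"
  obtains F where "proper_on (lines_of W) F" "F ` lines_of W \<subseteq> {..<c}"
proof -
  have z: "fvs.subspace {0 :: nat \<Rightarrow> 'a}" by (rule fvs.subspace_single_0)
  have zz: "{0} \<subseteq> W" "{0 :: nat \<Rightarrow> 'a} \<subseteq> ambient n"
    using fvs.subspace_0[OF W(1)] fvs.subspace_0[OF subspace_ambient] by auto
  have cc: "card W = card (ambient n :: 'a flat)" by (simp only: W(2) card_ambient)
  obtain \<phi> where \<phi>: "flinear \<phi>" "\<phi> ` W = ambient n" "\<phi> ` {0} = {0}" "inj_on \<phi> W"
    by (rule flag_isomorphism[OF z W(1) z subspace_ambient zz
          subspace_card_pos_imp_finite[OF W(2)] finite_ambient refl cc])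
  note \<phi> = \<phi>(1,2,4)
  have im: "\<phi> ` l \<in> pg_lines n" if "l \<in> lines_of W" for l
    using lines_of_image[OF \<phi>(1,3) that] \<phi>(2) by (simp only: pg_lines_eq_lines_of)
  have pf: "proper_on (pg_lines n) f" "f ` pg_lines n \<subseteq> {..<c}"
    using f line_coloring_iff_proper_on[of "pg_lines n" "ambient n" c f]
    by (simp_all only: pg_lines_eq_lines_of subset_refl simp_thms)
  show ?thesis
  proof (rule that)
    show "proper_on (lines_of W) (\<lambda>l. f (\<phi> ` l))"
      by (rule proper_on_transport[OF \<phi>(1,3,2) fvs.subspace_0[OF W(1)] subset_refl im pf(1)])
    show "(\<lambda>l. f (\<phi> ` l)) ` lines_of W \<subseteq> {..<c}" using pf(2) im by blast
  qed
qed

lemma hole_coloring_transport: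
  fixes U W :: "'a::{field,finite} flat"
  assumes n: "2 \<le> n" and UW: "fvs.subspace U" "fvs.subspace W" "U \<subseteq> W"
    and card: "card U = CARD('a) ^ (n - 1)" "card W = CARD('a) ^ (n + 1)"
    and hc: "hole_colorable TYPE('a) n c"
  obtains F where "proper_on {l \<in> lines_of W. \<not> l \<subseteq> U} F" "F ` {l \<in> lines_of W. \<not> l \<subseteq> U} \<subseteq> {..<c}"
    "\<And>l v. l \<in> lines_of W \<Longrightarrow> \<not> l \<subseteq> U \<Longrightarrow> v \<noteq> 0 \<Longrightarrow> v \<in> l \<Longrightarrow> v \<in> U \<Longrightarrow>
      F l < CARD('a) ^ (n - 2) * (CARD('a) + 1)"
proof -
  from hc obtain H :: "'a flat" and f where H: "H \<in> pg_subspaces n (n - 2)"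
    and f: "line_coloring (ipg_lines n H) c f"
    and inc': "\<forall>l\<in>ipg_incident_lines n H. f l < CARD('a) ^ (n - 2) * (CARD('a) + 1)"
    unfolding hole_colorable_def by (elim bexE exE conjE)
  note inc = inc'[rule_format]
  have n1: "n - 2 + 1 = n - 1" using n by simp
  have H': "fvs.subspace H" "card H = CARD('a) ^ (n - 1)" "H \<subseteq> ambient n"
    using H unfolding pg_subspaces_iff n1 by auto
  have cc: "card U = card H" "card W = card (ambient n :: 'a flat)"
    by (simp_all only: card H'(2) card_ambient)
  obtain \<phi> where \<phi>: "flinear \<phi>" "\<phi> ` W = ambient n" "\<phi> ` U = H" "inj_on \<phi> W"
    by (rule flag_isomorphism[OF UW(1,2) H'(1) subspace_ambient UW(3) H'(3)
          subspace_card_pos_imp_finite[OF card(2)] finite_ambient cc])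
  let ?L = "{l \<in> lines_of W. \<not> l \<subseteq> U}"
  have im: "\<phi> ` l \<in> ipg_lines n H" if "l \<in> ?L" for l
  proof -
    have "\<phi> ` l \<in> pg_lines n"
      using lines_of_image[OF \<phi>(1,4), of l] that \<phi>(2) unfolding pg_lines_eq_lines_of by simp
    moreover have "\<not> \<phi> ` l \<subseteq> \<phi> ` U"
    proof
      assume sub: "\<phi> ` l \<subseteq> \<phi> ` U"
      have lW: "l \<subseteq> W" using that by (auto simp: lines_of_def)
      have "x \<in> U" if x: "x \<in> l" for x
      proof -
        obtain u where u: "u \<in> U" "\<phi> x = \<phi> u" using sub x by blast
        have "x = u" by (rule inj_onD[OF \<phi>(4)]) (use u x lW UW(3) in auto)
        then show ?thesis using u by simp
      qed
      then show False using that by blast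
    qed
    ultimately show ?thesis using \<phi>(3) by (simp add: ipg_lines_def)
  qed
  have ipg: "ipg_lines n H \<subseteq> lines_of (ambient n)"
    unfolding pg_lines_eq_lines_of[symmetric] ipg_lines_def by blast
  have pf: "proper_on (ipg_lines n H) f" "f ` ipg_lines n H \<subseteq> {..<c}"
    using f unfolding line_coloring_iff_proper_on[OF ipg] by simp_all
  show ?thesis
  proof (rule that[of "\<lambda>l. f (\<phi> ` l)"])
    show "proper_on ?L (\<lambda>l. f (\<phi> ` l))"
      by (rule proper_on_transport[OF \<phi>(1,4,2) fvs.subspace_0[OF UW(2)] _ im pf(1)]) auto
    show "(\<lambda>l. f (\<phi> ` l)) ` ?L \<subseteq> {..<c}" using pf(2) im by blast
    fix l v assume l: "l \<in> lines_of W" "\<not> l \<subseteq> U" and v: "v \<noteq> 0" "v \<in> l" "v \<in> U"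
    have il: "\<phi> ` l \<in> ipg_lines n H" using im l by simp
    have "\<phi> v \<noteq> \<phi> 0" using \<phi>(4) v UW fvs.subspace_0[OF UW(2)] by (metis inj_onD subsetD)
    then have "\<phi> v \<noteq> 0" by (simp add: flinear_simps(4)[OF \<phi>(1)])
    then have "intersecting (\<phi> ` l) H"
      using intersecting_iff[of "\<phi> ` l" H] il H'(1) v \<phi>(3) by (auto simp: ipg_lines_def pg_lines_iff)
    then show "f (\<phi> ` l) < CARD('a) ^ (n - 2) * (CARD('a) + 1)"
      using inc il by (simp add: ipg_incident_lines_def)
  qed
qed

section \<open>Lifting lines along a projection\<close>

text \<open>The polynomial function takes the value \<open>0\<close> both at \<open>0\<close> and at \<open>1\<close>, so it is not surjective.\<close>
lemma rootless_value:
  assumes "0 < k"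
  shows "\<exists>c. \<forall>s::'a::{field,finite}. s ^ k * (s - 1) \<noteq> c"
proof -
  let ?f = "\<lambda>s::'a. s ^ k * (s - 1)"
  have "?f 0 = ?f 1" using assms by simp
  then have "\<not> inj ?f" using zero_neq_one injD[of ?f 0 1] by blast
  then have "\<not> surj ?f" using finite_UNIV_surj_inj[OF finite, of ?f] by blast
  then obtain c where "c \<notin> range ?f" by blast
  then have "?f s \<noteq> c" for s by (auto simp: image_iff)
  then show ?thesis by blast
qed

definition proj3 :: "(nat \<Rightarrow> 'a::field) \<Rightarrow> (nat \<Rightarrow> 'a)" where
  "proj3 v = (\<lambda>i. if i \<le> 3 then v i else 0)"

definition vertex :: "nat \<Rightarrow> 'a::field flat" where
  "vertex n = {v \<in> ambient n. proj3 v = 0}"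

lemma flinear_proj3: "flinear proj3"
  by (rule flinearI) (auto simp: proj3_def fscale_def fun_eq_iff)

lemmas proj3_simps = flinear_simps[OF flinear_proj3]

lemma proj3_ambient: "proj3 v \<in> ambient 3"
  by (simp add: proj3_def ambient_def)

lemma proj3_id: "v \<in> ambient 3 \<Longrightarrow> proj3 v = v"
  by (auto simp: proj3_def ambient_def fun_eq_iff)

lemma ambient_mono: "m \<le> n \<Longrightarrow> ambient m \<subseteq> ambient n"
  by (auto simp: ambient_def)

lemma subspace_vertex: "fvs.subspace (vertex n)"
  using subspace_ambient[of n] unfolding vertex_def fvs.subspace_def by (auto simp: proj3_simps)

lemma card_vertex:
  assumes "3 \<le> n"
  shows "card (vertex n :: 'a::{field,finite} flat) = CARD('a) ^ (n - 3)"
proof -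
  have "vertex n = {v :: nat \<Rightarrow> 'a. \<forall>i. i \<notin> {4..n} \<longrightarrow> v i = 0}"
    by (auto simp: vertex_def ambient_def proj3_def fun_eq_iff)
  then show ?thesis using card_supported_functions[of "{4..n}", where 'a = 'a] assms
    by (simp add: Suc_diff_le)
qed

text \<open>The companion matrix of a rootless polynomial has no eigenvector.\<close>
lemma eigenvector_free_map:
  assumes n: "5 \<le> n"
  obtains T :: "(nat \<Rightarrow> 'a::{field,finite}) \<Rightarrow> (nat \<Rightarrow> 'a)"
  where "flinear T" "\<And>v. v \<in> vertex n \<Longrightarrow> T v \<in> vertex n"
    "\<And>v s. v \<in> vertex n \<Longrightarrow> T v = fscale s v \<Longrightarrow> v = 0"
proof -
  \<comment> \<open>\<open>T\<close> below is the companion matrix of \<open>s ^ (n - 3) - s ^ (n - 4) - c\<close> on the coordinates \<open>4..n\<close>\<close>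
  obtain c :: 'a where c: "\<And>s. s ^ (n - 4) * (s - 1) \<noteq> c"
    using rootless_value[of "n - 4"] n by auto
  define T :: "(nat \<Rightarrow> 'a) \<Rightarrow> (nat \<Rightarrow> 'a)" where
    "T v = (\<lambda>i. if i = 4 then c * v n else if i = n then v (n - 1) + v n
                else if 4 < i \<and> i < n then v (i - 1) else 0)" for v
  show ?thesis
  proof (rule that[of T])
    show "flinear T"
      by (rule flinearI) (auto simp: T_def fscale_def fun_eq_iff algebra_simps)
    show "T v \<in> vertex n" if "v \<in> vertex n" for v
      using n by (auto simp: vertex_def ambient_def proj3_def T_def fun_eq_iff)
    fix v s assume v: "v \<in> vertex n" and eig: "T v = fscale s v"
    have e: "T v i = s * v i" for i using eig by (simp add: fscale_def)
    have down: "v (n - 1 - j) = s ^ j * (s - 1) * v n" if "j \<le> n - 5" for j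
      using that
    proof (induction j)
      case 0
      then show ?case using e[of n] n by (simp add: T_def algebra_simps)
    next
      case (Suc j)
      have i: "n - 1 - j \<noteq> 4" "n - 1 - j \<noteq> n" "4 < n - 1 - j \<and> n - 1 - j < n"
        "n - 1 - j - 1 = n - 1 - Suc j" using Suc.prems n by auto
      have "v (n - 1 - Suc j) = s * v (n - 1 - j)"
        using e[of "n - 1 - j"] unfolding T_def if_not_P[OF i(1)] if_not_P[OF i(2)] if_P[OF i(3)] i(4) .
      then show ?case using Suc by simp
    qed
    have "v 4 = s ^ (n - 5) * (s - 1) * v n" using down[of "n - 5"] n by simp
    moreover have "s * v 4 = c * v n" using e[of 4] by (simp add: T_def)
    moreover have "s * s ^ (n - 5) = s ^ (n - 4)"
    proof -
      have "n - 4 = Suc (n - 5)" using n by simp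
      then show ?thesis by simp
    qed
    ultimately have "s ^ (n - 4) * (s - 1) * v n = c * v n" by (metis mult.assoc)
    then have "(s ^ (n - 4) * (s - 1) - c) * v n = 0" by (simp add: left_diff_distrib)
    then have vn: "v n = 0" using c[of s] by simp
    have "v i = 0" for i
    proof (cases "4 \<le> i \<and> i < n")
      case True
      then have "i = n - 1 - (n - 1 - i)" "n - 1 - i \<le> n - 5" by auto
      then show ?thesis using down[of "n - 1 - i"] vn by simp
    next
      case False
      then consider "i \<le> 3" | "i = n" | "n < i" by linarith
      then show ?thesis
      proof cases
        assume "i \<le> 3"
        moreover have "proj3 v i = 0" using v by (simp add: vertex_def)
        ultimately show ?thesis by (simp add: proj3_def)
      qed (use v vn in \<open>auto simp: vertex_def ambient_def\<close>)
    qed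
    then show "v = 0" by (simp add: fun_eq_iff)
  qed
qed

text \<open>The lines that \<open>proj3\<close> maps bijectively to a line \<open>m\<close> are the graphs of the linear maps
  from \<open>m\<close> to the vertex; in a basis of \<open>m\<close> such a map is a pair \<open>(a, b)\<close> of vectors of the vertex.
  With \<open>T\<close> free of eigenvectors, the label \<open>b - T a\<close> splits them into as many classes of pairwise
  disjoint lines as the vertex has vectors: two maps with the same label differ by \<open>(d, T d)\<close>,
  and \<open>s d + t (T d) = 0\<close> only for \<open>d = 0\<close>.\<close>
lemma lift_labelling:
  fixes m :: "'a::{field,finite} flat"
  assumes n: "5 \<le> n" and m: "m \<in> pg_lines 3"
  obtains lab :: "'a flat \<Rightarrow> (nat \<Rightarrow> 'a)" where
    "\<And>l. l \<in> pg_lines n \<Longrightarrow> proj3 ` l = m \<Longrightarrow> lab l \<in> vertex n"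
    "proper_on {l \<in> pg_lines n. proj3 ` l = m} lab"
proof -
  obtain T :: "(nat \<Rightarrow> 'a) \<Rightarrow> (nat \<Rightarrow> 'a)" where T: "flinear T"
    "\<And>v. v \<in> vertex n \<Longrightarrow> T v \<in> vertex n"
    "\<And>v s. v \<in> vertex n \<Longrightarrow> T v = fscale s v \<Longrightarrow> v = 0"
    using eigenvector_free_map[OF n] by blast
  have m': "fvs.subspace m" "card m = CARD('a) ^ 2" "m \<subseteq> ambient 3" using m by (auto simp: pg_lines_iff)
  obtain v w where vw: "v \<in> m" "w \<in> m" "indep2 v w" "m = plane v w" by (rule line_basis[OF m'(1,2)])
  define up where "up l x = inv_into l proj3 x" for l :: "'a flat" and x
  define lab where "lab l = (up l w - w) - T (up l v - v)" for l
  let ?L = "{l \<in> pg_lines n. proj3 ` l = m}"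
  have l': "fvs.subspace l" "l \<subseteq> ambient n" "inj_on proj3 l" "proj3 ` l = m" if "l \<in> ?L" for l
  proof -
    show "fvs.subspace l" "l \<subseteq> ambient n" "proj3 ` l = m" using that by (auto simp: pg_lines_iff)
    have "card l = card m" using that m' by (auto simp: pg_lines_iff)
    then show "inj_on proj3 l" using that m'(2) subspace_card_pos_imp_finite[of l 2]
      by (intro eq_card_imp_inj_on) auto
  qed
  have up: "up l x \<in> l" "proj3 (up l x) = x" if "l \<in> ?L" "x \<in> m" for l x
    using l'(4)[OF that(1)] that(2) by (auto simp: up_def inv_into_into f_inv_into_f)
  have upU: "up l x - x \<in> vertex n" if "l \<in> ?L" "x \<in> m" for l x
  proof -
    have "x \<in> ambient 3" using that m' by blast
    moreover from this have "x \<in> ambient n" using ambient_mono[of 3 n] n by auto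
    ultimately show ?thesis
      using up[OF that] l'(2)[OF that(1)] fvs.subspace_diff[OF subspace_ambient]
      by (auto simp: vertex_def proj3_simps proj3_id)
  qed
  have coord: "x = fscale s (up l v) + fscale t (up l w)"
    if l: "l \<in> ?L" and x: "x \<in> l" and e: "proj3 x = fscale s v + fscale t w" for l x s t
  proof (rule inj_onD[OF l'(3)[OF l] _ x])
    show "proj3 x = proj3 (fscale s (up l v) + fscale t (up l w))"
      using e up[OF l] vw by (simp add: proj3_simps)
    show "fscale s (up l v) + fscale t (up l w) \<in> l"
      using l'(1)[OF l] up[OF l] vw by (simp add: fvs.subspace_add fvs.subspace_scale)
  qed
  have coords: "\<exists>s t. proj3 x = fscale s v + fscale t w" if "l \<in> ?L" "x \<in> l" for l x
  proof -
    have "proj3 x \<in> plane v w" using that vw(4) by blast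
    then show ?thesis by (auto simp: plane_def)
  qed
  show ?thesis
  proof (rule that[of lab])
    show "lab l \<in> vertex n" if "l \<in> pg_lines n" "proj3 ` l = m" for l
      unfolding lab_def
      by (rule fvs.subspace_diff[OF subspace_vertex upU T(2)[OF upU]]) (use vw that in auto)
    show "proper_on ?L lab"
      unfolding proper_on_def
    proof (intro ballI impI)
      fix l l' assume l: "l \<in> ?L" "l' \<in> ?L" and eq: "lab l = lab l'" and "\<exists>z. z \<noteq> 0 \<and> z \<in> l \<and> z \<in> l'"
      then obtain z where z: "z \<noteq> 0" "z \<in> l" "z \<in> l'" by blast
      obtain s t where st: "proj3 z = fscale s v + fscale t w" using coords[OF l(1) z(2)] by blast
      define d where "d = up l v - up l' v"
      have dU: "d \<in> vertex n"
        using fvs.subspace_diff[OF subspace_vertex upU[OF l(1) vw(1)] upU[OF l(2) vw(1)]] by (simp add: d_def)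
      have Td: "up l w - up l' w = T d"
        using eq by (simp add: lab_def d_def flinear_simps[OF T(1)] algebra_simps)
      have "fscale s (up l v) + fscale t (up l w) = fscale s (up l' v) + fscale t (up l' w)"
        using coord[OF l(1) z(2) st] coord[OF l(2) z(3) st] by simp
      then have "fscale s d + fscale t (up l w - up l' w) = 0"
        unfolding d_def fvs.scale_right_diff_distrib by (simp add: algebra_simps)
      then have sd: "fscale s d + fscale t (T d) = 0" unfolding Td .
      have "d = 0"
      proof (cases "t = 0")
        case True
        then have "s \<noteq> 0" using coord[OF l(1) z(2) st] z(1) by auto
        then show ?thesis using sd True by (simp add: fscale_eq_0_iff)
      next
        case False
        have "fscale t (T d) = fscale (- s) d" using sd by (simp add: add_eq_0_iff)
        then have "fscale (inverse t) (fscale t (T d)) = fscale (inverse t) (fscale (- s) d)" by simp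
        then have "T d = fscale (inverse t * - s) d" using False by simp
        then show ?thesis using T(3) dU by blast
      qed
      then have eqs: "up l v = up l' v" "up l w = up l' w"
        using Td by (simp_all add: d_def flinear_simps(4)[OF T(1)])
      have "x \<in> l2" if k: "l1 \<in> ?L" "l2 \<in> ?L" "up l1 v = up l2 v" "up l1 w = up l2 w" "x \<in> l1" for l1 l2 x
      proof -
        obtain a b where "proj3 x = fscale a v + fscale b w" using coords[OF k(1,5)] by blast
        then have "x = fscale a (up l2 v) + fscale b (up l2 w)" using coord[OF k(1,5)] k(3,4) by simp
        then show ?thesis using l'(1)[OF k(2)] up[OF k(2)] vw by (simp add: fvs.subspace_add fvs.subspace_scale)
      qed
      note sub = this
      show "l = l'"
      proof (rule equalityI; rule subsetI)
        show "x \<in> l'" if "x \<in> l" for x by (rule sub[OF l eqs that])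
        show "x \<in> l" if "x \<in> l'" for x by (rule sub[OF l(2,1) eqs[symmetric] that])
      qed
    qed
  qed
qed

section \<open>The coloring over a frame of spreads\<close>

lemma spread_line: "spread S \<Longrightarrow> l \<in> S \<Longrightarrow> l \<in> pg_lines 3"
  by (auto simp: spread_def)

lemma spread_unique:
  fixes S :: "'a::{field,finite} flat set"
  assumes "spread S" "l \<in> S" "m \<in> S" "v \<noteq> 0" "v \<in> l" "v \<in> m"
  shows "l = m"
proof (rule ccontr)
  assume "l \<noteq> m"
  then have "\<not> intersecting l m" using assms by (auto simp: spread_def)
  moreover have "fvs.subspace l" "fvs.subspace m"
    using spread_line[OF assms(1)] assms by (auto simp: pg_lines_iff)
  ultimately show False using intersecting_iff assms by blast
qed

lemma spread_covers:
  fixes S :: "'a::{field,finite} flat set"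
  assumes "spread S" "v \<in> ambient 3" "v \<noteq> 0"
  obtains l where "l \<in> S" "v \<in> l"
proof -
  have "fvs.span {v} \<in> pg_points 3"
    using assms subspace_ambient[of 3, where 'a = 'a] fvs.span_minimal[of "{v}" "ambient 3"]
    by (simp add: pg_subspaces_iff card_span_singleton)
  then obtain l where "l \<in> S" "fvs.span {v} \<subseteq> l" using assms(1) unfolding spread_def by blast
  then show ?thesis using that fvs.span_base[of v "{v}"] by blast
qed

lemma spread_nonempty:
  fixes S :: "'a::{field,finite} flat set"
  assumes "spread S" obtains l where "l \<in> S"
proof -
  define e :: "nat \<Rightarrow> 'a" where "e = (\<lambda>i. if i = 0 then 1 else 0)"
  have "e \<in> ambient 3" "e \<noteq> 0" by (auto simp: e_def ambient_def fun_eq_iff)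
  then show ?thesis using spread_covers[OF assms] that by blast
qed

definition cone :: "nat \<Rightarrow> 'a::field flat \<Rightarrow> 'a flat" where
  "cone n y = {v \<in> ambient n. proj3 v \<in> y}"

lemma subspace_cone: "fvs.subspace y \<Longrightarrow> fvs.subspace (cone n y)"
  using subspace_ambient[of n] unfolding cone_def fvs.subspace_def by (auto simp: proj3_simps)

lemma vertex_subset_cone: "fvs.subspace y \<Longrightarrow> vertex n \<subseteq> cone n y"
  by (auto simp: vertex_def cone_def fvs.subspace_0)

lemma card_cone:
  fixes y :: "'a::{field,finite} flat"
  assumes n: "3 \<le> n" and y: "y \<in> pg_lines 3"
  shows "card (cone n y) = CARD('a) ^ (n - 1)"
proof -
  have y': "fvs.subspace y" "card y = CARD('a) ^ 2" "y \<subseteq> ambient 3" using y by (auto simp: pg_lines_iff)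
  have "proj3 v = v" "v \<in> ambient n" if "v \<in> y" for v
    using that y'(3) n ambient_mono[of 3 n] by (auto simp: proj3_id)
  then have "v \<in> proj3 ` cone n y" if "v \<in> y" for v
    using that by (intro image_eqI[of _ _ v]) (auto simp: cone_def)
  then have im: "proj3 ` cone n y = y" by (auto simp: cone_def)
  have ker: "{v \<in> cone n y. proj3 v = 0} = vertex n"
    using fvs.subspace_0[OF y'(1)] by (auto simp: cone_def vertex_def)
  have "card (cone n y) = card (proj3 ` cone n y) * card {v \<in> cone n y. proj3 v = 0}"
  proof (rule card_eq_image_times_kernel)
    show "finite (cone n y)" by (simp add: cone_def finite_ambient)
  qed (use subspace_cone[OF y'(1)] in \<open>auto simp: fvs.subspace_add fvs.subspace_diff proj3_simps\<close>)
  also have "\<dots> = CARD('a) ^ 2 * CARD('a) ^ (n - 3)"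
    unfolding im ker y'(2) card_vertex[OF n] ..
  also have "\<dots> = CARD('a) ^ (n - 1)"
  proof -
    have "n - 1 = 2 + (n - 3)" using n by simp
    then show ?thesis by (simp only: power_add)
  qed
  finally show ?thesis .
qed

text \<open>A line meeting the vertex projects to a point or to zero, hence into a line of the spread \<open>P\<close>.\<close>
lemma line_in_cone_or_lift:
  fixes l :: "'a::{field,finite} flat"
  assumes P: "spread P" and l: "l \<in> pg_lines n" and no: "\<And>y. y \<in> P \<Longrightarrow> \<not> l \<subseteq> cone n y"
  shows "proj3 ` l \<in> pg_lines 3 - P" "\<And>v. v \<in> l \<Longrightarrow> v \<noteq> 0 \<Longrightarrow> proj3 v \<noteq> 0"
proof -
  have l': "fvs.subspace l" "card l = CARD('a) ^ 2" "l \<subseteq> ambient n" "finite l"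
    using l finite_subset[OF _ finite_ambient, of l n] by (auto simp: pg_lines_iff)
  show nz: "proj3 z \<noteq> 0" if z: "z \<in> l" "z \<noteq> 0" for z
  proof
    assume pz: "proj3 z = 0"
    obtain w where w: "w \<in> l" "l = plane z w" by (rule line_second_vector[OF l'(1,2) z])
    obtain y where y: "y \<in> P" "proj3 w \<in> y"
    proof (cases "proj3 w = 0")
      case True
      obtain y where "y \<in> P" by (rule spread_nonempty[OF P])
      moreover from this have "0 \<in> y"
        using spread_line[OF P] fvs.subspace_0 by (auto simp: pg_lines_iff)
      ultimately show ?thesis using that True by simp
    next
      case False
      then show ?thesis using spread_covers[OF P proj3_ambient] that by blast
    qed
    have "fvs.subspace y" using spread_line[OF P y(1)] by (simp add: pg_lines_iff)
    then have "proj3 x \<in> y" if "x \<in> l" for x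
      using that w(2) y(2) pz by (auto simp: plane_def proj3_simps fvs.subspace_scale)
    then have "l \<subseteq> cone n y" using l'(3) by (auto simp: cone_def)
    then show False using no[OF y(1)] by blast
  qed
  have "inj_on proj3 l"
  proof (rule inj_onI)
    fix x y assume xy: "x \<in> l" "y \<in> l" "proj3 x = proj3 y"
    then have "proj3 (x - y) = 0" by (simp add: proj3_simps)
    then show "x = y" using nz[of "x - y"] fvs.subspace_diff[OF l'(1) xy(1,2)] by auto
  qed
  then have "card (proj3 ` l) = CARD('a) ^ 2" using l'(2) by (simp add: card_image)
  then have "proj3 ` l \<in> pg_lines 3"
    using flinear_image_subspace[OF flinear_proj3 l'(1)] proj3_ambient by (auto simp: pg_lines_iff)
  moreover have "proj3 ` l \<notin> P"
  proof
    assume "proj3 ` l \<in> P"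
    then show False using no[of "proj3 ` l"] l'(3) by (auto simp: cone_def)
  qed
  ultimately show "proj3 ` l \<in> pg_lines 3 - P" by blast
qed

text \<open>The data of the recursion: the spreads \<open>P\<close> and \<open>S i\<close> of Property E, a full coloring \<open>G y0\<close> of one
  cone, and colorings \<open>G y\<close> of the other cones with the vertex as hole. Here \<open>k\<close> is the number of colors
  that \<open>G y\<close> may use on the lines meeting the vertex.\<close>
locale spread_frame =
  fixes n c N :: nat and P :: "'a::{field,finite} flat set" and S :: "nat \<Rightarrow> 'a flat set"
    and y0 :: "'a flat" and G :: "'a flat \<Rightarrow> 'a flat \<Rightarrow> nat" and k :: nat
  defines "k \<equiv> CARD('a) ^ (n - 4) * (CARD('a) + 1)"
  assumes n: "5 \<le> n" and P: "spread P" and S: "\<And>i. i < N \<Longrightarrow> spread (S i)"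
    and mult_P: "\<And>l. l \<in> P \<Longrightarrow> card {i. i < N \<and> l \<in> S i} = CARD('a) + 1"
    and mult_not_P: "\<And>l. l \<in> pg_lines 3 - P \<Longrightarrow> card {i. i < N \<and> l \<in> S i} = CARD('a)"
    and one_P: "\<And>i l m. i < N \<Longrightarrow> l \<in> P \<Longrightarrow> m \<in> P \<Longrightarrow> l \<in> S i \<Longrightarrow> m \<in> S i \<Longrightarrow> l = m"
    and y0: "y0 \<in> P"
    and full: "proper_on (lines_of (cone n y0)) (G y0)" "G y0 ` lines_of (cone n y0) \<subseteq> {..<c}"
    and holed: "\<And>y. y \<in> P \<Longrightarrow> y \<noteq> y0 \<Longrightarrow> proper_on {l \<in> lines_of (cone n y). \<not> l \<subseteq> vertex n} (G y)"
      "\<And>y. y \<in> P \<Longrightarrow> y \<noteq> y0 \<Longrightarrow> G y ` {l \<in> lines_of (cone n y). \<not> l \<subseteq> vertex n} \<subseteq> {..<c}"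
      "\<And>y l v. y \<in> P \<Longrightarrow> y \<noteq> y0 \<Longrightarrow> l \<in> lines_of (cone n y) \<Longrightarrow> \<not> l \<subseteq> vertex n \<Longrightarrow>
         v \<noteq> 0 \<Longrightarrow> v \<in> l \<Longrightarrow> v \<in> vertex n \<Longrightarrow> G y l < k"
begin

text \<open>The colors reserved for \<open>m\<close>. There are \<open>k\<close> of them for a line of \<open>P\<close>, and as many as vectors in the
  vertex for any other line: the multiplicities \<open>q + 1\<close> and \<open>q\<close> in Property E serve exactly this purpose.\<close>
definition slots :: "'a flat \<Rightarrow> (nat \<times> nat) set" where
  "slots m = {i. i < N \<and> m \<in> S i} \<times> {..<CARD('a) ^ (n - 4)}"

lemma finite_slots: "finite (slots m)"
  by (simp add: slots_def)

lemma card_slots_P: "y \<in> P \<Longrightarrow> card (slots y) = k"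
  by (simp add: slots_def card_cartesian_product mult_P k_def mult.commute del: mult_Suc mult_Suc_right)

lemma card_slots_not_P:
  assumes "m \<in> pg_lines 3 - P" shows "card (slots m) = card (vertex n :: 'a flat)"
proof -
  have "n - 3 = Suc (n - 4)" using n by simp
  then have "CARD('a) ^ (n - 3) = CARD('a) * CARD('a) ^ (n - 4)" by simp
  then show ?thesis using n by (simp add: slots_def card_cartesian_product mult_not_P[OF assms] card_vertex)
qed

definition \<gamma> :: "'a flat \<Rightarrow> nat \<Rightarrow> nat \<times> nat" where
  "\<gamma> y = (SOME g. bij_betw g {..<k} (slots y))"

definition \<beta> :: "'a flat \<Rightarrow> (nat \<Rightarrow> 'a) \<Rightarrow> nat \<times> nat" where
  "\<beta> m = (SOME g. bij_betw g (vertex n) (slots m))"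

definition lab :: "'a flat \<Rightarrow> 'a flat \<Rightarrow> (nat \<Rightarrow> 'a)" where
  "lab m = (SOME h. (\<forall>l\<in>{l \<in> pg_lines n. proj3 ` l = m}. h l \<in> vertex n) \<and>
     proper_on {l \<in> pg_lines n. proj3 ` l = m} h)"

lemma \<gamma>: "y \<in> P \<Longrightarrow> bij_betw (\<gamma> y) {..<k} (slots y)"
  unfolding \<gamma>_def using card_slots_P[of y] finite_slots[of y]
  by (intro someI_ex[of "\<lambda>g. bij_betw g {..<k} (slots y)"] finite_same_card_bij) auto

lemma \<beta>: "m \<in> pg_lines 3 - P \<Longrightarrow> bij_betw (\<beta> m) (vertex n) (slots m)"
  unfolding \<beta>_def using card_slots_not_P[of m] finite_slots[of m]
  by (intro someI_ex[of "\<lambda>g. bij_betw g (vertex n) (slots m)"] finite_same_card_bij)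
     (auto simp: vertex_def finite_ambient)

lemma lab:
  assumes "m \<in> pg_lines 3"
  shows "l \<in> pg_lines n \<Longrightarrow> proj3 ` l = m \<Longrightarrow> lab m l \<in> vertex n"
    and "proper_on {l \<in> pg_lines n. proj3 ` l = m} (lab m)"
proof -
  obtain h :: "'a flat \<Rightarrow> (nat \<Rightarrow> 'a)" where
    h: "\<And>l. l \<in> pg_lines n \<Longrightarrow> proj3 ` l = m \<Longrightarrow> h l \<in> vertex n"
    "proper_on {l \<in> pg_lines n. proj3 ` l = m} h"
    using lift_labelling[OF n assms] by blast
  then have "\<exists>h :: 'a flat \<Rightarrow> (nat \<Rightarrow> 'a). (\<forall>l\<in>{l \<in> pg_lines n. proj3 ` l = m}. h l \<in> vertex n) \<and>
     proper_on {l \<in> pg_lines n. proj3 ` l = m} h" by (intro exI[of _ h]) simp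
  from someI_ex[OF this, folded lab_def]
  show "l \<in> pg_lines n \<Longrightarrow> proj3 ` l = m \<Longrightarrow> lab m l \<in> vertex n"
    and "proper_on {l \<in> pg_lines n. proj3 ` l = m} (lab m)" by auto
qed

text \<open>Lines inside the vertex lie in every cone; they are colored as lines of the cone over \<open>y0\<close>.\<close>
definition base :: "'a flat \<Rightarrow> 'a flat" where
  "base l = (if l \<subseteq> cone n y0 then y0 else (SOME y. y \<in> P \<and> l \<subseteq> cone n y))"

definition filled :: "'a flat \<Rightarrow> bool" where
  "filled l \<longleftrightarrow> (\<exists>y\<in>P. l \<subseteq> cone n y)"

text \<open>In a cone over \<open>y\<close> the first \<open>k\<close> colors become the slots of \<open>y\<close>, and the others are common to all
  cones. A lifted line takes the slot of its projection that its label selects.\<close>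
definition color :: "'a flat \<Rightarrow> (nat \<times> nat) + nat" where
  "color l = (if filled l
     then (let v = G (base l) l in if v < k then Inl (\<gamma> (base l) v) else Inr (v - k))
     else Inl (\<beta> (proj3 ` l) (lab (proj3 ` l) l)))"

definition palette :: "((nat \<times> nat) + nat) set" where
  "palette = Inl ` ({..<N} \<times> {..<CARD('a) ^ (n - 4)}) \<union> Inr ` {..<c - k}"

lemma P_subspace: "y \<in> P \<Longrightarrow> fvs.subspace y"
  using spread_line[OF P] by (auto simp: pg_lines_iff)

lemma cone_Int:
  assumes "y \<in> P" "y' \<in> P" "y \<noteq> y'" "v \<in> cone n y" "v \<in> cone n y'"
  shows "v \<in> vertex n"
proof -
  have "proj3 v = 0"
    using spread_unique[OF P assms(1,2), of "proj3 v"] assms(3-5) by (auto simp: cone_def)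
  then show ?thesis using assms(4) by (simp add: cone_def vertex_def)
qed

lemma base:
  assumes "filled l"
  shows "base l \<in> P" "l \<subseteq> cone n (base l)" "base l \<noteq> y0 \<Longrightarrow> \<not> l \<subseteq> cone n y0"
    "base l \<noteq> y0 \<Longrightarrow> \<not> l \<subseteq> vertex n"
proof -
  have ex: "\<exists>y. y \<in> P \<and> l \<subseteq> cone n y" using assms unfolding filled_def by blast
  have *: "base l \<in> P \<and> l \<subseteq> cone n (base l)"
    using someI_ex[OF ex] y0 by (auto simp: base_def)
  then show "base l \<in> P" "l \<subseteq> cone n (base l)" by auto
  show ne: "base l \<noteq> y0 \<Longrightarrow> \<not> l \<subseteq> cone n y0" by (auto simp: base_def)
  show "base l \<noteq> y0 \<Longrightarrow> \<not> l \<subseteq> vertex n"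
    using ne vertex_subset_cone[OF P_subspace[OF y0], of n] by blast
qed

lemma filled_lines_of: "l \<in> pg_lines n \<Longrightarrow> filled l \<Longrightarrow> l \<in> lines_of (cone n (base l))"
  using base(2)[of l] by (auto simp: pg_lines_iff lines_of_def)

lemma filled_bound: "l \<in> pg_lines n \<Longrightarrow> filled l \<Longrightarrow> G (base l) l < c"
  using filled_lines_of[of l] base(1,4)[of l] full(2) holed(2)[OF base(1)[of l]]
  by (cases "base l = y0") (auto simp: image_subset_iff)

lemma filled_hole:
  assumes "l \<in> pg_lines n" "filled l" "base l \<noteq> y0" "v \<noteq> 0" "v \<in> l" "v \<in> vertex n"
  shows "G (base l) l < k"
  using holed(3)[OF base(1)[OF assms(2)] assms(3) filled_lines_of[OF assms(1,2)] base(4)[OF assms(2,3)]]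
    assms by blast

lemma filled_proper:
  assumes "l \<in> pg_lines n" "m \<in> pg_lines n" "filled l" "filled m" "base l = base m"
    "G (base l) l = G (base m) m" "v \<noteq> 0" "v \<in> l" "v \<in> m"
  shows "l = m"
proof (cases "base l = y0")
  case True
  then show ?thesis
    using proper_onD[OF full(1) _ _ _ assms(7-9)] assms filled_lines_of by metis
next
  case False
  have "l \<in> {l \<in> lines_of (cone n (base l)). \<not> l \<subseteq> vertex n}"
    "m \<in> {l \<in> lines_of (cone n (base l)). \<not> l \<subseteq> vertex n}"
    using False assms(5) filled_lines_of[OF assms(1,3)] filled_lines_of[OF assms(2,4)]
      base(4)[OF assms(3)] base(4)[OF assms(4)] by simp_all
  then show ?thesis
    using proper_onD[OF holed(1)[OF base(1)[OF assms(3)] False] _ _ _ assms(7-9)] assms(5,6) by simp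
qed

lemma lifted:
  assumes "l \<in> pg_lines n" "\<not> filled l"
  shows "proj3 ` l \<in> pg_lines 3 - P" "v \<in> l \<Longrightarrow> v \<noteq> 0 \<Longrightarrow> proj3 v \<noteq> 0"
    "\<beta> (proj3 ` l) (lab (proj3 ` l) l) \<in> slots (proj3 ` l)"
proof -
  have no: "\<not> l \<subseteq> cone n y" if "y \<in> P" for y using assms(2) that by (auto simp: filled_def)
  show m: "proj3 ` l \<in> pg_lines 3 - P" by (rule line_in_cone_or_lift(1)[OF P assms(1) no])
  show "v \<in> l \<Longrightarrow> v \<noteq> 0 \<Longrightarrow> proj3 v \<noteq> 0" by (rule line_in_cone_or_lift(2)[OF P assms(1) no])
  have "lab (proj3 ` l) l \<in> vertex n" using lab(1)[of "proj3 ` l" l] m assms(1) by blast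
  then show "\<beta> (proj3 ` l) (lab (proj3 ` l) l) \<in> slots (proj3 ` l)"
    using bij_betw_apply[OF \<beta>[OF m]] by blast
qed

lemma color_filled_Inl:
  "filled l \<Longrightarrow> color l = Inl s \<Longrightarrow> G (base l) l < k \<and> s = \<gamma> (base l) (G (base l) l) \<and> s \<in> slots (base l)"
  using bij_betw_apply[OF \<gamma>[OF base(1)]] by (auto simp: color_def Let_def split: if_splits)

lemma color_filled_Inr: "filled l \<Longrightarrow> color l = Inr r \<Longrightarrow> k \<le> G (base l) l \<and> r = G (base l) l - k"
  by (auto simp: color_def Let_def split: if_splits)

lemma color_lifted: "\<not> filled l \<Longrightarrow> color l = Inl (\<beta> (proj3 ` l) (lab (proj3 ` l) l))"
  by (simp add: color_def)

text \<open>A common point would project to a common point of two different lines of one spread \<open>S i\<close>.\<close>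
lemma filled_lifted_disjoint:
  assumes "y \<in> P" "l \<in> pg_lines n" "\<not> filled l" "s \<in> slots y" "s \<in> slots (proj3 ` l)"
    "v \<noteq> 0" "v \<in> l" "v \<in> cone n y"
  shows False
proof -
  obtain i where i: "i < N" "y \<in> S i" "proj3 ` l \<in> S i" using assms(4,5) by (auto simp: slots_def)
  have "proj3 v \<noteq> 0" using lifted(2)[OF assms(2,3,7,6)] .
  moreover have "proj3 v \<in> y" "proj3 v \<in> proj3 ` l" using assms by (auto simp: cone_def)
  ultimately have "y = proj3 ` l" using spread_unique[OF S[OF i(1)] i(2,3)] by blast
  then show False using lifted(1)[OF assms(2,3)] assms(1) by blast
qed

lemma slots_P_disjoint: "y \<in> P \<Longrightarrow> y' \<in> P \<Longrightarrow> s \<in> slots y \<Longrightarrow> s \<in> slots y' \<Longrightarrow> y = y'"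
  using one_P by (auto simp: slots_def)

text \<open>Two lines in cones over different lines of \<open>P\<close> cannot share a slot, because no spread \<open>S i\<close> contains two
  lines of \<open>P\<close>; and if they share a common color, then one of them lies in a cone with a hole, where
  common colors avoid the vertex, which is the intersection of the two cones. Two lifted lines with
  the same slot that meet have the same projection, hence the same label.\<close>
lemma color_proper: "proper_on (pg_lines n) color"
  unfolding proper_on_def
proof (intro ballI impI)
  fix l m :: "'a flat"
  assume l: "l \<in> pg_lines n" and m: "m \<in> pg_lines n" and eq: "color l = color m"
    and "\<exists>v. v \<noteq> 0 \<and> v \<in> l \<and> v \<in> m"
  then obtain v where v: "v \<noteq> 0" "v \<in> l" "v \<in> m" by blast
  consider "filled l" "filled m" | "filled l" "\<not> filled m" | "\<not> filled l" "filled m"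
    | "\<not> filled l" "\<not> filled m" by blast
  then show "l = m"
  proof cases
    case 1
    note b = base[OF 1(1)] base[OF 1(2)]
    show ?thesis
    proof (cases "color l")
      case (Inl s)
      note s = color_filled_Inl[OF 1(1) Inl] color_filled_Inl[OF 1(2) Inl[unfolded eq]]
      then have bb: "base l = base m" using slots_P_disjoint b by blast
      then have "G (base l) l = G (base m) m"
        using s bij_betw_imp_inj_on[OF \<gamma>[OF b(1)]] by (auto dest: inj_onD)
      then show ?thesis using filled_proper[OF l m 1 bb] v by blast
    next
      case (Inr r)
      note r = color_filled_Inr[OF 1(1) Inr] color_filled_Inr[OF 1(2) Inr[unfolded eq]]
      have bb: "base l = base m"
      proof (rule ccontr)
        assume ne: "base l \<noteq> base m"
        then have vU: "v \<in> vertex n" using cone_Int[OF b(1) b(5)] b(2) b(6) v by blast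
        show False
        proof (cases "base l = y0")
          case True
          then show ?thesis using filled_hole[OF m 1(2) _ v(1,3) vU] ne r by simp
        next
          case False
          then show ?thesis using filled_hole[OF l 1(1) _ v(1,2) vU] r by simp
        qed
      qed
      have "G (base l) l = G (base m) m" using r by linarith
      then show ?thesis using filled_proper[OF l m 1 bb] v by blast
    qed
  next
    case 2
    then show ?thesis
      using filled_lifted_disjoint[OF base(1)[OF 2(1)] m 2(2) _ lifted(3)[OF m 2(2)] v(1,3)]
        base(2)[OF 2(1)] v(2) color_filled_Inl[OF 2(1)] eq color_lifted[OF 2(2)] by auto
  next
    case 3
    then show ?thesis
      using filled_lifted_disjoint[OF base(1)[OF 3(2)] l 3(1) _ lifted(3)[OF l 3(1)] v(1,2)]
        base(2)[OF 3(2)] v(3) color_filled_Inl[OF 3(2)] eq color_lifted[OF 3(1)] by auto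
  next
    case 4
    have e: "\<beta> (proj3 ` l) (lab (proj3 ` l) l) = \<beta> (proj3 ` m) (lab (proj3 ` m) m)"
      using eq color_lifted[OF 4(1)] color_lifted[OF 4(2)] by simp
    have "\<beta> (proj3 ` l) (lab (proj3 ` l) l) \<in> slots (proj3 ` m)"
      unfolding e by (rule lifted(3)[OF m 4(2)])
    then obtain i where i: "i < N" "proj3 ` l \<in> S i" "proj3 ` m \<in> S i"
      using lifted(3)[OF l 4(1)] by (auto simp: slots_def)
    have "proj3 v \<noteq> 0" using lifted(2)[OF l 4(1) v(2,1)] .
    then have pm: "proj3 ` l = proj3 ` m"
      using spread_unique[OF S[OF i(1)] i(2,3)] v by blast
    note mm = lifted(1)[OF m 4(2)]
    have "lab (proj3 ` m) l = lab (proj3 ` m) m"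
      using mm e[unfolded pm] by (intro inj_onD[OF bij_betw_imp_inj_on[OF \<beta>[OF mm]]] lab(1) l m pm refl) auto
    then show ?thesis
      using proper_onD[OF lab(2)[of "proj3 ` m"], of l m v] mm l m pm v by simp
  qed
qed

lemma slots_subset: "slots m \<subseteq> {..<N} \<times> {..<CARD('a) ^ (n - 4)}"
  by (auto simp: slots_def)

lemma color_in_palette: "l \<in> pg_lines n \<Longrightarrow> color l \<in> palette"
proof (cases "filled l")
  case True
  assume l: "l \<in> pg_lines n"
  show ?thesis
  proof (cases "color l")
    case (Inl s)
    then show ?thesis using color_filled_Inl[OF True Inl] slots_subset by (auto simp: palette_def)
  next
    case (Inr r)
    then show ?thesis using color_filled_Inr[OF True Inr] filled_bound[OF l True]
      by (auto simp: palette_def)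
  qed
next
  case False
  assume l: "l \<in> pg_lines n"
  then show ?thesis
    using lifted(3)[OF l False] slots_subset color_lifted[OF False] by (auto simp: palette_def)
qed

text \<open>The slots of \<open>y0\<close> and the common colors do not occur on the lines that meet the cone over \<open>y0\<close>
  without being contained in it.\<close>
definition hole_palette :: "((nat \<times> nat) + nat) set" where
  "hole_palette = Inl ` ({i. i < N \<and> y0 \<notin> S i} \<times> {..<CARD('a) ^ (n - 4)})"

lemma hole_palette_Inl: "s \<in> {..<N} \<times> {..<CARD('a) ^ (n - 4)} \<Longrightarrow> s \<notin> slots y0 \<Longrightarrow> Inl s \<in> hole_palette"
  by (auto simp: hole_palette_def slots_def)

lemma incident_color:
  assumes "l \<in> ipg_incident_lines n (cone n y0)"
  shows "color l \<in> hole_palette"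
proof -
  have l: "l \<in> pg_lines n" and nsub: "\<not> l \<subseteq> cone n y0" and int: "intersecting l (cone n y0)"
    using assms by (auto simp: ipg_incident_lines_def ipg_lines_def)
  have "fvs.subspace l" using l by (simp add: pg_lines_iff)
  then obtain v where v: "v \<noteq> 0" "v \<in> l" "v \<in> cone n y0"
    using int intersecting_iff subspace_cone[OF P_subspace[OF y0]] by blast
  show ?thesis
  proof (cases "filled l")
    case True
    then have ne: "base l \<noteq> y0" using base(2)[OF True] nsub by auto
    have "v \<in> vertex n" using cone_Int[OF base(1)[OF True] y0 ne] base(2)[OF True] v by blast
    then have "G (base l) l < k" using filled_hole[OF l True ne v(1,2)] by blast
    then obtain s where s: "color l = Inl s" by (auto simp: color_def True Let_def)
    then have "s \<in> slots (base l)" using color_filled_Inl[OF True s] by blast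
    moreover from this have "s \<notin> slots y0" using slots_P_disjoint[OF base(1)[OF True] y0] ne by blast
    ultimately show ?thesis unfolding s using hole_palette_Inl slots_subset by blast
  next
    case False
    have "\<beta> (proj3 ` l) (lab (proj3 ` l) l) \<notin> slots y0"
      using filled_lifted_disjoint[OF y0 l False _ lifted(3)[OF l False] v] by blast
    then show ?thesis
      unfolding color_lifted[OF False]
      by (rule hole_palette_Inl[OF subsetD[OF slots_subset lifted(3)[OF l False]]])
  qed
qed

lemma card_palette: "finite palette" "card palette = N * CARD('a) ^ (n - 4) + (c - k)"
proof -
  show "finite palette" by (simp add: palette_def)
  have "card palette = card (Inl ` ({..<N} \<times> {..<CARD('a) ^ (n - 4)}) :: ((nat \<times> nat) + nat) set)
      + card (Inr ` {..<c - k} :: ((nat \<times> nat) + nat) set)"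
    unfolding palette_def by (rule card_Un_disjoint) auto
  then show "card palette = N * CARD('a) ^ (n - 4) + (c - k)"
    by (simp add: card_image card_cartesian_product)
qed

lemma card_hole_palette: "hole_palette \<subseteq> palette"
  "card hole_palette = (N - (CARD('a) + 1)) * CARD('a) ^ (n - 4)"
proof -
  show "hole_palette \<subseteq> palette" by (auto simp: hole_palette_def palette_def)
  have "{i. i < N \<and> y0 \<notin> S i} = {..<N} - {i. i < N \<and> y0 \<in> S i}" by auto
  then have "card {i. i < N \<and> y0 \<notin> S i} = N - (CARD('a) + 1)"
    using mult_P[OF y0] by (simp add: card_Diff_subset subset_iff)
  then show "card hole_palette = (N - (CARD('a) + 1)) * CARD('a) ^ (n - 4)"
    by (simp add: hole_palette_def card_image card_cartesian_product)
qed

lemma frame_coloring: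
  obtains f where "line_coloring (pg_lines n :: 'a flat set) (N * CARD('a) ^ (n - 4) + (c - k)) f"
    "\<And>l. l \<in> ipg_incident_lines n (cone n y0) \<Longrightarrow> f l < (N - (CARD('a) + 1)) * CARD('a) ^ (n - 4)"
proof -
  obtain h where h: "inj_on h palette" "h ` palette \<subseteq> {..<N * CARD('a) ^ (n - 4) + (c - k)}"
    "h ` hole_palette \<subseteq> {..<(N - (CARD('a) + 1)) * CARD('a) ^ (n - 4)}"
    using relabel_colors[OF card_palette(1) eq_refl[OF card_palette(2)] card_hole_palette(1) eq_refl[OF card_hole_palette(2)]]
    by blast
  have im: "color ` pg_lines n \<subseteq> palette" using color_in_palette by blast
  show ?thesis
  proof (rule that[of "\<lambda>l. h (color l)"])
    have "proper_on (pg_lines n) (\<lambda>l. h (color l))" by (rule proper_on_relabel[OF color_proper h(1) im])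
    moreover have "(\<lambda>l. h (color l)) ` pg_lines n \<subseteq> {..<N * CARD('a) ^ (n - 4) + (c - k)}"
      using im h(2) by blast
    ultimately show "line_coloring (pg_lines n :: 'a flat set) (N * CARD('a) ^ (n - 4) + (c - k)) (\<lambda>l. h (color l))"
      using line_coloring_iff_proper_on[of "pg_lines n" "ambient n"]
      unfolding pg_lines_eq_lines_of by blast
    show "h (color l) < (N - (CARD('a) + 1)) * CARD('a) ^ (n - 4)"
      if "l \<in> ipg_incident_lines n (cone n y0)" for l
      using incident_color[OF that] h(3) by blast
  qed
qed

end

section \<open>Parallelisms of the three-dimensional space: color classes\<close>

lemma colorable_by_classes:
  fixes C :: "'i \<Rightarrow> 'a::{field,finite} flat set"
  assumes I: "finite I" "card I \<le> c"
    and cover: "\<And>l. l \<in> pg_lines n \<Longrightarrow> \<exists>i\<in>I. l \<in> C i"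
    and disj: "\<And>i l m v. i \<in> I \<Longrightarrow> l \<in> pg_lines n \<Longrightarrow> m \<in> pg_lines n \<Longrightarrow> l \<in> C i \<Longrightarrow> m \<in> C i \<Longrightarrow>
      v \<noteq> 0 \<Longrightarrow> v \<in> l \<Longrightarrow> v \<in> m \<Longrightarrow> l = m"
  shows "colorable (pg_lines n :: 'a flat set) c"
proof -
  have "\<forall>l\<in>pg_lines n. \<exists>i. i \<in> I \<and> l \<in> C i" using cover by blast
  then have "\<exists>g. \<forall>l\<in>pg_lines n. g l \<in> I \<and> l \<in> C (g l)" by (rule bchoice)
  then obtain g where g0: "\<forall>l\<in>pg_lines n. g l \<in> I \<and> l \<in> C (g l)" by (rule exE)
  note g = bspec[OF g0, THEN conjunct1] bspec[OF g0, THEN conjunct2]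
  have pg: "proper_on (pg_lines n) g"
    unfolding proper_on_def
  proof (intro ballI impI)
    fix l m :: "'a flat" assume l: "l \<in> pg_lines n" "m \<in> pg_lines n" "g l = g m" "\<exists>v. v \<noteq> 0 \<and> v \<in> l \<and> v \<in> m"
    then obtain v where v: "v \<noteq> 0" "v \<in> l" "v \<in> m" by blast
    have "m \<in> C (g l)" using g(2)[OF l(2)] l(3) by simp
    show "l = m" by (rule disj[OF g(1)[OF l(1)] l(1,2) g(2)[OF l(1)] \<open>m \<in> C (g l)\<close> v])
  qed
  obtain h :: "'i \<Rightarrow> nat" where h: "inj_on h I" "h ` I \<subseteq> {..<c}"
    by (rule relabel_colors[OF I empty_subsetI eq_refl[OF card.empty]])
  have "g ` pg_lines n \<subseteq> I" using g(1) by blast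
  then have "proper_on (pg_lines n) (\<lambda>l. h (g l))" by (rule proper_on_relabel[OF pg h(1)])
  moreover have "(\<lambda>l. h (g l)) ` pg_lines n \<subseteq> {..<c}" using g(1) h(2) by blast
  moreover have sub: "(pg_lines n :: 'a flat set) \<subseteq> lines_of (ambient n)"
    by (simp only: pg_lines_eq_lines_of subset_refl)
  ultimately have "line_coloring (pg_lines n :: 'a flat set) c (\<lambda>l. h (g l))"
    unfolding line_coloring_iff_proper_on[OF sub] by blast
  then show ?thesis unfolding colorable_def by blast
qed

section \<open>A quadratic extension field and a second copy of it\<close>

text \<open>The polynomial \<open>s\<^sup>2 - s - nonroot\<close> is irreducible.\<close>
definition nonroot :: "'a::{field,finite}" where
  "nonroot = (SOME c. \<forall>s. s ^ 1 * (s - 1) \<noteq> c)"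

lemma nonroot: "s * (s - 1) \<noteq> (nonroot :: 'a::{field,finite})"
proof -
  have "\<forall>s::'a. s ^ 1 * (s - 1) \<noteq> nonroot"
    unfolding nonroot_def by (rule someI_ex) (rule rootless_value, simp)
  then show ?thesis by simp
qed

text \<open>\<open>Quad a b\<close> stands for \<open>a + b \<omega>\<close>, where \<open>\<omega>\<^sup>2 = \<omega> + nonroot\<close>.\<close>
datatype 'a quad = Quad (qre: 'a) (qim: 'a)

lemma quad_eq_iff: "x = y \<longleftrightarrow> qre x = qre y \<and> qim x = qim y"
  by (cases x; cases y) simp

definition qnorm :: "'a::{field,finite} quad \<Rightarrow> 'a" where
  "qnorm x = qre x * qre x + qre x * qim x - nonroot * (qim x * qim x)"

instantiation quad :: ("{field,finite}") field
begin

definition "0 = Quad 0 0"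
definition "1 = Quad 1 0"
definition "x + y = Quad (qre x + qre y) (qim x + qim y)"
definition "- x = Quad (- qre x) (- qim x)"
definition "x - y = Quad (qre x - qre y) (qim x - qim y)"
definition "x * y = Quad (qre x * qre y + nonroot * (qim x * qim y))
  (qre x * qim y + qim x * qre y + qim x * qim y)"
definition "inverse x = Quad ((qre x + qim x) / qnorm x) (- qim x / qnorm x)"
definition "x div y = x * inverse (y :: 'a quad)"

lemmas quad_defs = zero_quad_def one_quad_def plus_quad_def uminus_quad_def minus_quad_def
  times_quad_def

lemma qnorm_eq_0:
  fixes x :: "'a quad" assumes "qnorm x = 0" shows "x = 0"
proof (cases "qim x = 0")
  case True
  then show ?thesis using assms by (simp add: qnorm_def quad_defs quad_eq_iff)
next
  case False
  let ?s = "- qre x / qim x"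
  have "?s * (?s - 1) = nonroot"
    using assms False unfolding qnorm_def by (simp add: field_simps)
  then show ?thesis using nonroot by blast
qed

instance
proof
  fix x y z :: "'a quad"
  show "x * y * z = x * (y * z)" by (simp add: quad_defs algebra_simps)
  show "x \<noteq> 0 \<Longrightarrow> inverse x * x = 1"
  proof -
    assume "x \<noteq> 0"
    then have "qnorm x \<noteq> 0" using qnorm_eq_0 by blast
    then show ?thesis
      by (simp add: quad_eq_iff quad_defs inverse_quad_def divide_simps)
         (simp add: qnorm_def algebra_simps)
  qed
  show "inverse (0 :: 'a quad) = 0" by (simp add: inverse_quad_def quad_defs)
  show "x div y = x * inverse y" by (rule divide_quad_def)
  show "x * y = y * x" by (simp add: times_quad_def mult.commute add.commute)
  show "(x + y) * z = x * z + y * z" by (simp add: quad_defs algebra_simps)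
  show "x + y + z = x + (y + z)" "x + y = y + x" by (simp_all add: plus_quad_def add.assoc add.commute)
  show "0 + x = x" "- x + x = 0" "x - y = x + - y" "1 * x = x" "(0 :: 'a quad) \<noteq> 1"
    by (simp_all add: quad_defs)
qed

end

lemma finite_card_quad: "finite (UNIV :: 'a::{field,finite} quad set)" "card (UNIV :: 'a quad set) = CARD('a) ^ 2"
proof -
  have b: "bij_betw (\<lambda>(x, y). Quad x y) (UNIV :: ('a \<times> 'a) set) UNIV"
    by (rule bij_betw_byWitness[where f' = "\<lambda>x. (qre x, qim x)"]) auto
  then show "finite (UNIV :: 'a quad set)" using bij_betw_finite[OF b] by simp
  show "card (UNIV :: 'a quad set) = CARD('a) ^ 2"
    using bij_betw_same_card[OF b] by (simp add: card_cartesian_product power2_eq_square flip: UNIV_Times_UNIV)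
qed

definition emb :: "'a::{field,finite} \<Rightarrow> 'a quad" where
  "emb s = Quad s 0"

lemma emb_simps: "emb (s + t) = emb s + emb t" "emb (s - t) = emb s - emb t" "emb (s * t) = emb s * emb t"
  "emb 0 = 0" "emb 1 = 1" "emb s = 0 \<longleftrightarrow> s = 0" "emb s = emb t \<longleftrightarrow> s = t"
  by (simp_all add: emb_def quad_defs)

lemma emb_divide: "emb (s / t) = emb s / emb t"
proof (cases "t = 0")
  case False
  then have "emb (s / t) * emb t = emb s" by (simp flip: emb_simps(3))
  then show ?thesis using False by (simp add: emb_simps field_simps)
qed (simp add: emb_simps)

definition \<omega> :: "'a::{field,finite} quad" where
  "\<omega> = Quad 0 1"

lemma quad_expand: "x = emb (qre x) + emb (qim x) * \<omega>"
  by (simp add: emb_def \<omega>_def quad_defs quad_eq_iff)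

text \<open>The conjugate of multiplication by \<open>\<omega>\<close> under the diagonal map with entries \<open>t\<close> and \<open>1\<close>. For
  \<open>t\<close> other than \<open>0\<close> and \<open>1\<close> it generates a second copy of the quadratic extension inside the
  matrix ring.\<close>
definition twist :: "'a::{field,finite} \<Rightarrow> 'a quad \<Rightarrow> 'a quad" where
  "twist t x = Quad (nonroot * t * qim x) (qre x / t + qim x)"

lemma twist_linear: "twist t (x + y) = twist t x + twist t y" "twist t (emb s * x) = emb s * twist t x"
  "twist t 0 = 0" "twist t (x - y) = twist t x - twist t y"
  by (simp_all add: twist_def quad_defs emb_def algebra_simps add_divide_distrib diff_divide_distrib)

lemma twist_no_eigenvector:
  assumes t: "t \<noteq> 0" and eig: "twist t x = emb s * x"
  shows "x = 0"
proof -
  have a: "nonroot * t * qim x = s * qre x" and b: "qre x / t + qim x = s * qim x"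
    using eig by (simp_all add: twist_def quad_defs emb_def)
  have c: "qre x = t * (s - 1) * qim x" using b t by (simp add: field_simps)
  have "t * (nonroot - s * (s - 1)) * qim x = 0" using a unfolding c by (simp add: algebra_simps)
  then have "qim x = 0" using t nonroot[of s] by simp
  then show ?thesis using c by (simp add: quad_eq_iff quad_defs)
qed

text \<open>The twisted map is far from commuting with \<open>\<omega>\<close>: the commutator, applied to multiplications,
  is a bijection. Hence every linear map on the extension field has the form
  \<open>x \<mapsto> b * x + twist t (a * x)\<close>.\<close>
lemma twist_commutator_surj:
  fixes t :: "'a::{field,finite}"
  assumes t: "t \<noteq> 0" "t \<noteq> 1"
  shows "\<exists>a. twist t (a * \<omega>) - \<omega> * twist t a = d"
proof -
  let ?D = "\<lambda>a. twist t (a * \<omega>) - \<omega> * twist t a"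
  have ker: "a = 0" if "?D a = 0" for a
  proof -
    let ?k = "nonroot :: 'a"
    have "qre (?D a) = 0" "qim (?D a) = 0" using that by (simp_all add: zero_quad_def)
    then have e1: "?k * ((t * t - 1) * qre a + (t - 1) * t * qim a) = 0"
      and e2: "(t - 1) * t * qre a - ?k * (t * t - 1) * t * qim a = 0"
      using t by (simp_all add: twist_def \<omega>_def quad_defs field_simps)
    have k0: "?k \<noteq> 0" using nonroot[of 0] by simp
    have "(t * t - 1) * qre a + (t - 1) * t * qim a = 0" using e1 k0 by (simp only: mult_eq_0_iff simp_thms)
    then have "(t - 1) * ((t + 1) * qre a + t * qim a) = 0" by (simp add: algebra_simps)
    then have f1: "(t + 1) * qre a + t * qim a = 0" using t by simp
    have "(t - 1) * t * (qre a - ?k * (t + 1) * qim a) = 0" using e2 by (simp add: algebra_simps)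
    then have f2: "qre a = ?k * (t + 1) * qim a" using t by simp
    have f3: "(?k * (t + 1) * (t + 1) + t) * qim a = 0" using f1 unfolding f2 by (simp add: algebra_simps)
    have "?k * (t + 1) * (t + 1) + t \<noteq> 0"
    proof
      assume z: "?k * (t + 1) * (t + 1) + t = 0"
      define w where "w = t + 1"
      have kw: "?k * w * w = - t" using z unfolding w_def by (simp only: eq_neg_iff_add_eq_0)
      then have w: "w \<noteq> 0" using t by auto
      have "t / w - 1 = - (1 / w)" using w by (simp add: w_def field_simps)
      then have "t / w * (t / w - 1) = - t / (w * w)" by simp
      also have "\<dots> = ?k" unfolding kw[symmetric] using w by simp
      finally have "t / w * (t / w - 1) = ?k" .
      then show False using nonroot by blast
    qed
    then have "qim a = 0" using f3 by simp
    then show ?thesis using f2 by (simp add: quad_eq_iff quad_defs)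
  qed
  have swap: "(x - y) - (p - r) = (x - p) - (y - r)" for x y p r :: "'a quad" by simp
  have diff: "?D (a - b) = ?D a - ?D b" for a b
    unfolding left_diff_distrib twist_linear(4) right_diff_distrib by (rule swap)
  have "inj ?D"
  proof (rule injI)
    fix a b assume "?D a = ?D b"
    then have "?D (a - b) = 0" unfolding diff by (simp only: diff_self)
    then have "a - b = 0" by (rule ker)
    then show "a = b" by simp
  qed
  then have "surj ?D" by (rule finite_UNIV_inj_surj[OF finite_card_quad(1)])
  then have "d \<in> range ?D" by (rule ssubst) (rule UNIV_I)
  then obtain a where a: "d = ?D a" by (rule rangeE)
  show ?thesis by (rule exI[of _ a]) (rule a[symmetric])
qed

section \<open>Parallelisms over fields with at least three elements\<close>

definition vec :: "'a::{field,finite} quad \<Rightarrow> 'a quad \<Rightarrow> (nat \<Rightarrow> 'a)" where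
  "vec x y = (\<lambda>i. if i = 0 then qre x else if i = 1 then qim x else
     if i = 2 then qre y else if i = 3 then qim y else 0)"

definition fstq :: "(nat \<Rightarrow> 'a) \<Rightarrow> 'a quad" where "fstq v = Quad (v 0) (v 1)"

definition sndq :: "(nat \<Rightarrow> 'a) \<Rightarrow> 'a quad" where "sndq v = Quad (v 2) (v 3)"

lemma fstq_vec [simp]: "fstq (vec x y) = x" and sndq_vec [simp]: "sndq (vec x y) = y"
  by (simp_all add: fstq_def sndq_def vec_def)

lemma vec_eq_iff: "vec x y = vec x' y' \<longleftrightarrow> x = x' \<and> y = y'"
  using fstq_vec sndq_vec by metis

lemma vec_0: "vec 0 0 = 0"
  by (auto simp: vec_def fun_eq_iff zero_quad_def)

lemma vec_coords:
  assumes "v \<in> ambient 3" shows "vec (fstq v) (sndq v) = v"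
proof
  fix i :: nat
  have "i = 0 \<or> i = 1 \<or> i = 2 \<or> i = 3 \<or> 3 < i" by linarith
  then show "vec (fstq v) (sndq v) i = v i"
    using assms by (auto simp: vec_def fstq_def sndq_def ambient_def)
qed

lemma coords_linear:
  "fstq (v + w) = fstq v + fstq w" "sndq (v + w) = sndq v + sndq w"
  "fstq (v - w) = fstq v - fstq w"
  "fstq (fscale s v) = emb s * fstq v" "sndq (fscale s v) = emb s * sndq v"
  "fstq 0 = 0" "sndq 0 = 0"
  by (simp_all add: fstq_def sndq_def quad_defs emb_def fscale_def)

text \<open>A vector \<open>vec x y\<close> is a pair of elements of the extension field \<open>K\<close>. The lines that are \<open>K\<close>-subspaces
  are the axis \<open>x = 0\<close> and the graphs of multiplications; they form the central class.\<close>
definition mult_graph :: "'a::{field,finite} quad \<Rightarrow> 'a flat" where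
  "mult_graph b = range (\<lambda>x. vec x (b * x))"

definition axis :: "'a::{field,finite} flat" where
  "axis = range (vec 0)"

definition transversal :: "'a::{field,finite} quad \<Rightarrow> 'a quad \<Rightarrow> 'a quad \<Rightarrow> 'a flat" where
  "transversal a b u = range (\<lambda>(s, t). vec (a * (emb s * u)) (b * (emb s * u) + emb t * u))"

definition twist_graph :: "'a::{field,finite} \<Rightarrow> 'a quad \<Rightarrow> 'a quad \<Rightarrow> 'a \<Rightarrow> 'a \<Rightarrow> 'a flat" where
  "twist_graph t a b \<alpha> \<beta> = range (\<lambda>z. vec (a * z) (b * z + emb \<alpha> * twist t z + emb \<beta> * z))"

definition central_class :: "'a::{field,finite} flat set" where
  "central_class = insert axis (range mult_graph)"

text \<open>For \<open>a = 1\<close> and \<open>b = 0\<close>, the graphs of \<open>\<alpha> * T + \<beta>\<close> with \<open>T = twist t\<close> and scalars \<open>\<alpha>\<close>, \<open>\<beta>\<close> are, together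
  with the axis, the spread of the second extension field. Those with \<open>\<alpha> = 0\<close>, and the axis, form a
  regulus of the central class; the transversals are its opposite regulus and replace it. In general
  the class is the image of this spread under \<open>(x, y) \<mapsto> (a x, b x + y)\<close>.\<close>
definition derived_class :: "'a::{field,finite} \<Rightarrow> 'a quad \<Rightarrow> 'a quad \<Rightarrow> 'a flat set" where
  "derived_class t a b = {transversal a b u | u. u \<noteq> 0} \<union> {twist_graph t a b \<alpha> \<beta> | \<alpha> \<beta>. \<alpha> \<noteq> 0}"

lemma central_class_disjoint:
  assumes "l \<in> central_class" "m \<in> central_class" "v \<noteq> 0" "v \<in> l" "v \<in> m"
  shows "l = m"
proof -
  have "\<not> (v \<in> axis \<and> v \<in> mult_graph b)" for b :: "'a quad"
    using assms(3) by (auto simp: axis_def mult_graph_def vec_eq_iff vec_0)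
  moreover have "b = b'" if vb: "v \<in> mult_graph b" "v \<in> mult_graph b'" for b b' :: "'a quad"
  proof -
    obtain x where x: "v = vec x (b * x)" using vb(1) by (auto simp: mult_graph_def)
    obtain y where y: "v = vec y (b' * y)" using vb(2) by (auto simp: mult_graph_def)
    have "x \<noteq> 0" using x assms(3) by (auto simp: vec_0)
    then show ?thesis using x y by (auto simp: vec_eq_iff)
  qed
  ultimately show ?thesis using assms unfolding central_class_def by blast
qed

lemma twist_relation:
  assumes t: "t \<noteq> 0" and eq: "emb s * twist t x = emb r * x" and x: "x \<noteq> 0"
  shows "s = 0 \<and> r = 0"
proof -
  have s: "s = 0"
  proof (rule ccontr)
    assume "s \<noteq> 0"
    then have "twist t x = emb (r / s) * x" using eq by (simp add: emb_divide emb_simps field_simps)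
    then show False using twist_no_eigenvector[OF t] x by blast
  qed
  then show ?thesis using eq x by (simp add: emb_simps)
qed

lemma transversal_cong:
  assumes "r \<noteq> 0"
  shows "transversal a b (emb r * u) = transversal a b u"
proof -
  have "bij (\<lambda>(s, t). (r * s, r * t))"
    by (rule bij_betw_byWitness[where f' = "\<lambda>(s, t). (s / r, t / r)"]) (use assms in auto)
  then have "range (\<lambda>(s, t). (r * s, r * t)) = UNIV" by (rule bij_is_surj)
  then have "transversal a b u =
    (\<lambda>(s, t). vec (a * (emb s * u)) (b * (emb s * u) + emb t * u)) ` range (\<lambda>(s, t). (r * s, r * t))"
    unfolding transversal_def by simp
  also have "\<dots> = transversal a b (emb r * u)"
    unfolding transversal_def image_image
    by (intro image_cong refl) (auto simp: emb_simps mult_ac)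
  finally show ?thesis ..
qed

lemma derived_class_disjoint:
  fixes t :: "'a::{field,finite}"
  assumes t: "t \<noteq> 0" and a: "a \<noteq> 0"
    and lm: "l \<in> derived_class t a b" "m \<in> derived_class t a b" and v: "v \<noteq> 0" "v \<in> l" "v \<in> m"
  shows "l = m"
proof -
  have tr_tr: "transversal a b u = transversal a b u'"
    if u: "u \<noteq> 0" "u' \<noteq> 0" "v \<in> transversal a b u" "v \<in> transversal a b u'" for u u'
  proof -
    obtain s r where e: "v = vec (a * (emb s * u)) (b * (emb s * u) + emb r * u)"
      using u(3) by (auto simp: transversal_def)
    obtain s' r' where e': "v = vec (a * (emb s' * u')) (b * (emb s' * u') + emb r' * u')"
      using u(4) by (auto simp: transversal_def)
    have e1: "emb s * u = emb s' * u'" and e2: "emb r * u = emb r' * u'"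
      using e e' a by (auto simp: vec_eq_iff)
    have "s \<noteq> 0 \<or> r \<noteq> 0" using e v(1) by (auto simp: emb_simps vec_0)
    then obtain k k' where k: "k \<noteq> 0" "emb k * u = emb k' * u'" using e1 e2 by blast
    have k': "k' \<noteq> 0" using k u by (auto simp: emb_simps)
    have "u = emb (k' / k) * u'" using k by (simp add: emb_divide emb_simps field_simps)
    moreover have "k' / k \<noteq> 0" using k k' by simp
    ultimately show ?thesis using transversal_cong by metis
  qed
  have tr_tw: False
    if u: "u \<noteq> 0" "\<alpha> \<noteq> 0" "v \<in> transversal a b u" "v \<in> twist_graph t a b \<alpha> \<beta>" for u \<alpha> \<beta>
  proof -
    obtain s r where e1: "v = vec (a * (emb s * u)) (b * (emb s * u) + emb r * u)"
      using u(3) by (auto simp: transversal_def)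
    obtain z where e2: "v = vec (a * z) (b * z + emb \<alpha> * twist t z + emb \<beta> * z)"
      using u(4) by (auto simp: twist_graph_def)
    note e = e1 e2
    have z: "z = emb s * u" and e3: "emb r * u = emb \<alpha> * twist t z + emb \<beta> * z"
      using e a by (auto simp: vec_eq_iff)
    have s: "s \<noteq> 0"
    proof
      assume "s = 0"
      then show False using z e(2) v(1) by (simp add: emb_simps twist_linear vec_0)
    qed
    have "emb (\<alpha> * s) * twist t u = emb (r - \<beta> * s) * u"
      using e3 unfolding z twist_linear(2) by (simp add: emb_simps algebra_simps)
    then have "\<alpha> * s = 0" using twist_relation[OF t _ u(1)] by blast
    then show False using u(2) s by simp
  qed
  have tw_tw: "\<alpha> = \<alpha>' \<and> \<beta> = \<beta>'"
    if u: "v \<in> twist_graph t a b \<alpha> \<beta>" "v \<in> twist_graph t a b \<alpha>' \<beta>'" for \<alpha> \<beta> \<alpha>' \<beta>'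
  proof -
    obtain z where e1: "v = vec (a * z) (b * z + emb \<alpha> * twist t z + emb \<beta> * z)"
      using u(1) by (auto simp: twist_graph_def)
    obtain z' where e2: "v = vec (a * z') (b * z' + emb \<alpha>' * twist t z' + emb \<beta>' * z')"
      using u(2) by (auto simp: twist_graph_def)
    note e = e1 e2
    have zz: "z = z'" using e a by (auto simp: vec_eq_iff)
    then have "emb (\<alpha> - \<alpha>') * twist t z = emb (\<beta>' - \<beta>) * z"
      using e by (simp add: vec_eq_iff emb_simps algebra_simps)
    moreover have "z \<noteq> 0" using e(1) v(1) by (auto simp: twist_linear vec_0)
    ultimately have "\<alpha> - \<alpha>' = 0 \<and> \<beta>' - \<beta> = 0" by (rule twist_relation[OF t])
    then show ?thesis by simp
  qed
  have l: "(\<exists>u. u \<noteq> 0 \<and> l = transversal a b u) \<or> (\<exists>\<alpha> \<beta>. \<alpha> \<noteq> 0 \<and> l = twist_graph t a b \<alpha> \<beta>)"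
    and m: "(\<exists>u. u \<noteq> 0 \<and> m = transversal a b u) \<or> (\<exists>\<alpha> \<beta>. \<alpha> \<noteq> 0 \<and> m = twist_graph t a b \<alpha> \<beta>)"
    using lm by (auto simp: derived_class_def)
  from l m show ?thesis
  proof (elim disjE exE conjE)
    fix u u' assume "u \<noteq> 0" "l = transversal a b u" "u' \<noteq> 0" "m = transversal a b u'"
    then show ?thesis using tr_tr v by simp
  next
    fix u \<alpha> \<beta> assume "u \<noteq> 0" "l = transversal a b u" "\<alpha> \<noteq> 0" "m = twist_graph t a b \<alpha> \<beta>"
    then show ?thesis using tr_tw v by blast
  next
    fix u \<alpha> \<beta> assume "u \<noteq> 0" "m = transversal a b u" "\<alpha> \<noteq> 0" "l = twist_graph t a b \<alpha> \<beta>"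
    then show ?thesis using tr_tw v by blast
  next
    fix \<alpha> \<beta> \<alpha>' \<beta>' assume e: "l = twist_graph t a b \<alpha> \<beta>" "m = twist_graph t a b \<alpha>' \<beta>'"
    then have "\<alpha> = \<alpha>' \<and> \<beta> = \<beta>'" using tw_tw v by blast
    then show ?thesis using e by simp
  qed
qed

lemma line_eq_range:
  fixes l :: "'a::{field,finite} flat"
  assumes l: "l \<in> pg_lines 3" and sub: "l \<subseteq> Z" and Z: "finite Z" "card Z \<le> CARD('a) ^ 2"
  shows "l = Z"
  using card_seteq[OF Z(1) sub] Z(2) l by (simp add: pg_lines_iff)

lemma range_quad:
  fixes f :: "'a::{field,finite} quad \<Rightarrow> 'b"
  shows "finite (range f)" "card (range f) \<le> CARD('a) ^ 2"
  using card_image_le[of UNIV f] finite_card_quad[where 'a = 'a] by auto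

lemma range_pair:
  fixes f :: "'a::{field,finite} \<times> 'a \<Rightarrow> 'b"
  shows "finite (range f)" "card (range f) \<le> CARD('a) ^ 2"
  using card_image_le[of UNIV f] by (auto simp: card_cartesian_product power2_eq_square simp flip: UNIV_Times_UNIV)

text \<open>Composing with the maps \<open>(x, y) \<mapsto> (\<alpha> x, y + \<beta> x)\<close> for scalars \<open>\<alpha>\<close>, \<open>\<beta>\<close> permutes the lines of the
  derived spread, so the multiplier \<open>a\<close> matters only up to a scalar factor and \<open>b\<close> only modulo scalars.\<close>
lemma derived_class_normalize:
  assumes r: "r \<noteq> 0"
  shows "derived_class t (a * emb r) (b * emb r + emb p) \<subseteq> derived_class t a b"
proof -
  have "transversal (a * emb r) (b * emb r + emb p) u = transversal a b u" for u
  proof -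
    have "bij (\<lambda>(s, t). (r * s, t + p * s))"
      by (rule bij_betw_byWitness[where f' = "\<lambda>(s, t). (s / r, t - p * (s / r))"]) (use r in auto)
    then have "range (\<lambda>(s, t). (r * s, t + p * s)) = UNIV" by (rule bij_is_surj)
    then have "transversal a b u =
      (\<lambda>(s, t). vec (a * (emb s * u)) (b * (emb s * u) + emb t * u)) ` range (\<lambda>(s, t). (r * s, t + p * s))"
      unfolding transversal_def by simp
    also have "\<dots> = transversal (a * emb r) (b * emb r + emb p) u"
      unfolding transversal_def image_image
      by (intro image_cong refl) (auto simp: emb_simps algebra_simps)
    finally show ?thesis ..
  qed
  moreover have "twist_graph t (a * emb r) (b * emb r + emb p) \<alpha> \<beta> = twist_graph t a b (\<alpha> / r) ((p + \<beta>) / r)" for \<alpha> \<beta>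
  proof -
    have c: "emb (x / r) * (emb r * y) = emb x * y" for x y
      using r by (simp add: emb_divide emb_simps)
    have "bij (\<lambda>z. emb r * z)"
      by (rule bij_betw_byWitness[where f' = "\<lambda>z. z / emb r"]) (use r in \<open>auto simp: emb_simps\<close>)
    then have "range (\<lambda>z. emb r * z) = UNIV" by (rule bij_is_surj)
    then have "twist_graph t a b (\<alpha> / r) ((p + \<beta>) / r) =
      (\<lambda>z. vec (a * z) (b * z + emb (\<alpha> / r) * twist t z + emb ((p + \<beta>) / r) * z)) ` range (\<lambda>z. emb r * z)"
      unfolding twist_graph_def by simp
    also have "\<dots> = twist_graph t (a * emb r) (b * emb r + emb p) \<alpha> \<beta>"
      unfolding twist_graph_def image_image
      unfolding twist_linear(2) c
      by (intro image_cong refl) (simp add: emb_simps algebra_simps)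
    finally show ?thesis ..
  qed
  ultimately show ?thesis using r unfolding derived_class_def by auto
qed

text \<open>A line different from the axis either meets it in a point, and then it is a transversal of a suitable
  class, or it is the graph of a linear map \<open>x \<mapsto> b * x + T (a * x)\<close>. For \<open>a = 0\<close> this graph is in the central
  class; otherwise the substitution \<open>z = a * x\<close> turns it into a twist graph.\<close>
lemma line_in_some_class:
  fixes l :: "'a::{field,finite} flat"
  assumes l: "l \<in> pg_lines 3" and t: "t \<noteq> 0" "t \<noteq> 1"
  shows "l \<in> central_class \<or> (\<exists>a b. a \<noteq> 0 \<and> l \<in> derived_class t a b)"
proof -
  have l': "fvs.subspace l" "card l = CARD('a) ^ 2" "l \<subseteq> ambient 3" "finite l"
    using l finite_subset[OF _ finite_ambient, of l 3] by (auto simp: pg_lines_iff)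
  have co: "vec (fstq v) (sndq v) = v" if "v \<in> l" for v using vec_coords l'(3) that by blast
  consider "\<forall>v\<in>l. fstq v = 0" | v w where "v \<in> l" "fstq v \<noteq> 0" "w \<in> l" "w \<noteq> 0" "fstq w = 0"
    | "\<forall>w\<in>l. fstq w = 0 \<longrightarrow> w = 0" by blast
  then show ?thesis
  proof cases
    case 1
    have "v \<in> axis" if "v \<in> l" for v
    proof -
      have "vec 0 (sndq v) = v" using co[OF that] 1 that by simp
      then show ?thesis unfolding axis_def by (metis rangeI)
    qed
    then have "l = axis"
      unfolding axis_def by (intro line_eq_range[OF l _ range_quad]) (auto simp: axis_def)
    then show ?thesis by (simp add: central_class_def)
  next
    case 2
    obtain x where x: "x \<in> l" "l = plane w x" by (rule line_second_vector[OF l'(1,2) 2(3,4)])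
    define u where "u = sndq w"
    have u: "u \<noteq> 0" using co[OF 2(3)] 2(4,5) vec_0 by (auto simp: u_def)
    have fx: "fstq x \<noteq> 0" using 2(1,2,5) x(2) by (auto simp: plane_def coords_linear)
    let ?a = "fstq x / u" and ?b = "sndq x / u"
    have "y \<in> transversal ?a ?b u" if y: "y \<in> l" for y
    proof -
      obtain r s where y': "y = fscale r w + fscale s x" using y x(2) by (auto simp: plane_def)
      have "y = vec (fstq y) (sndq y)" using co[OF y] by simp
      also have "\<dots> = vec (?a * (emb s * u)) (?b * (emb s * u) + emb r * u)"
        using u 2(5) by (simp add: y' coords_linear u_def mult.commute add.commute)
      finally show ?thesis unfolding transversal_def by (intro image_eqI[of _ _ "(s, r)"]) auto
    qed
    then have "l = transversal ?a ?b u"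
      unfolding transversal_def by (intro line_eq_range[OF l _ range_pair]) (auto simp: transversal_def)
    moreover have "?a \<noteq> 0" using fx u by simp
    ultimately show ?thesis using u unfolding derived_class_def by blast
  next
    case 3
    have "inj_on fstq l"
    proof (rule inj_onI)
      fix x y assume xy: "x \<in> l" "y \<in> l" "fstq x = fstq y"
      then have "fstq (x - y) = 0" by (simp add: coords_linear)
      then show "x = y" using 3 fvs.subspace_diff[OF l'(1) xy(1,2)] by auto
    qed
    then have "card (fstq ` l) = card (UNIV :: 'a quad set)"
      using l'(2) by (simp add: card_image finite_card_quad)
    then have im: "fstq ` l = UNIV" by (intro card_subset_eq finite_card_quad) auto
    obtain v where v: "v \<in> l" "fstq v = 1" using im by (metis UNIV_I image_iff)
    obtain w where w: "w \<in> l" "fstq w = \<omega>" using im by (metis UNIV_I image_iff)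
    obtain a where a: "twist t (a * \<omega>) - \<omega> * twist t a = sndq w - \<omega> * sndq v"
      using twist_commutator_surj[OF t] by blast
    define b where "b = sndq v - twist t a"
    have sw: "sndq w = b * \<omega> + twist t (a * \<omega>)" using a by (simp add: b_def algebra_simps)
    have graph: "y = vec (fstq y) (b * fstq y + twist t (a * fstq y))" if y: "y \<in> l" for y
    proof -
      define s where "s = qre (fstq y)"
      define r where "r = qim (fstq y)"
      have fy: "fstq y = emb s + emb r * \<omega>" unfolding s_def r_def by (rule quad_expand)
      define z where "z = fscale s v + fscale r w"
      have "z \<in> l" using v w l'(1) by (simp add: z_def fvs.subspace_add fvs.subspace_scale)
      moreover have "fstq z = fstq y" by (simp add: z_def fy coords_linear v w)
      ultimately have yz: "y = z" using \<open>inj_on fstq l\<close> y by (metis inj_onD)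
      have "sndq y = emb s * sndq v + emb r * sndq w" by (simp add: yz z_def coords_linear)
      also have "\<dots> = b * fstq y + (emb s * twist t a + emb r * twist t (a * \<omega>))"
        by (simp add: fy sw b_def algebra_simps)
      also have "emb s * twist t a + emb r * twist t (a * \<omega>) = twist t (a * fstq y)"
        by (simp add: fy twist_linear flip: twist_linear(2)) (simp add: algebra_simps twist_linear(1)[symmetric])
      finally show ?thesis using co[OF y] by simp
    qed
    show ?thesis
    proof (cases "a = 0")
      case True
      have "y \<in> mult_graph b" if "y \<in> l" for y
        using graph[OF that] True unfolding mult_graph_def by (simp add: twist_linear image_iff) blast
      then have "l = mult_graph b"
        unfolding mult_graph_def by (intro line_eq_range[OF l _ range_quad]) (auto simp: mult_graph_def)
      then show ?thesis by (simp add: central_class_def)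
    next
      case False
      have "y \<in> twist_graph t (1 / a) (b / a) 1 0" if "y \<in> l" for y
      proof -
        have "y = vec (1 / a * (a * fstq y)) (b / a * (a * fstq y) + emb 1 * twist t (a * fstq y) + emb 0 * (a * fstq y))"
          using graph[OF that] False by (simp add: emb_simps)
        then show ?thesis unfolding twist_graph_def by (intro image_eqI[of _ _ "a * fstq y"]) auto
      qed
      then have "l = twist_graph t (1 / a) (b / a) 1 0"
        unfolding twist_graph_def by (intro line_eq_range[OF l _ range_quad]) (auto simp: twist_graph_def)
      moreover have "twist_graph t (1 / a) (b / a) 1 0 \<in> derived_class t (1 / a) (b / a)"
        unfolding derived_class_def by (intro UnI2 CollectI exI[of _ "1 :: 'a"] exI[of _ "0 :: 'a"]) simp
      ultimately have "l \<in> derived_class t (1 / a) (b / a)" by simp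
      moreover have "1 / a \<noteq> 0" using False by simp
      ultimately show ?thesis by (intro disjI2 exI conjI)
    qed
  qed
qed

text \<open>Representatives of the nonzero \<open>a\<close> modulo scalar factors, and of the \<open>b\<close> modulo addition of scalars.\<close>
definition class_index :: "('a::{field,finite} quad \<times> 'a quad) set" where
  "class_index = (insert (Quad 0 1) (range (Quad 1))) \<times> range (Quad 0)"

lemma class_index: "finite (class_index :: ('a::{field,finite} quad \<times> 'a quad) set)"
  "card (class_index :: ('a quad \<times> 'a quad) set) \<le> (CARD('a) + 1) * CARD('a)"
proof -
  show "finite (class_index :: ('a quad \<times> 'a quad) set)" by (simp add: class_index_def)
  have "card (range (Quad (0 :: 'a))) \<le> CARD('a)" "card (range (Quad (1 :: 'a))) \<le> CARD('a)"
    by (simp_all add: card_image_le)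
  moreover have "card (insert (Quad 0 1) (range (Quad (1::'a)))) \<le> Suc (card (range (Quad (1::'a))))"
    by (simp add: card_insert_if)
  ultimately show "card (class_index :: ('a quad \<times> 'a quad) set) \<le> (CARD('a) + 1) * CARD('a)"
    unfolding class_index_def card_cartesian_product by (intro mult_le_mono) auto
qed

lemma class_index_nonzero: "(a, b) \<in> class_index \<Longrightarrow> a \<noteq> 0"
  by (auto simp: class_index_def zero_quad_def)

lemma normalized_class:
  fixes t :: "'a::{field,finite}"
  assumes "a \<noteq> 0"
  shows "\<exists>(a', b')\<in>class_index. derived_class t a b \<subseteq> derived_class t a' b'"
proof -
  obtain a' r where a': "a' \<in> insert (Quad 0 1) (range (Quad 1))" "r \<noteq> 0" "a = a' * emb r"
  proof (cases "qre a = 0")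
    case True
    then show ?thesis using assms that[of "Quad 0 1" "qim a"] by (auto simp: quad_eq_iff quad_defs emb_def)
  next
    case False
    then show ?thesis using that[of "Quad 1 (qim a / qre a)" "qre a"] by (auto simp: quad_eq_iff quad_defs emb_def)
  qed
  have "b = Quad 0 (qim b / r) * emb r + emb (qre b)"
    using a'(2) by (simp add: quad_eq_iff quad_defs emb_def)
  then have "derived_class t a b \<subseteq> derived_class t a' (Quad 0 (qim b / r))"
    using derived_class_normalize[OF a'(2), of t a' "Quad 0 (qim b / r)" "qre b"] a'(3) by simp
  moreover have "(a', Quad 0 (qim b / r)) \<in> class_index" using a'(1) by (simp add: class_index_def)
  ultimately show ?thesis by blast
qed

lemma parallelism_large:
  assumes "3 \<le> CARD('a::{field,finite})"
  shows "colorable (pg_lines 3 :: 'a flat set) (\<Sum>i<3. CARD('a) ^ i)"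
proof -
  have "card {0, 1::'a} \<noteq> CARD('a)" using assms by (simp add: card_insert_if)
  then have "{0, 1::'a} \<noteq> UNIV" by metis
  then obtain t :: 'a where t: "t \<noteq> 0" "t \<noteq> 1" by blast
  define C where "C i = (case i of None \<Rightarrow> central_class | Some (a, b) \<Rightarrow> derived_class t a b)" for i
  define I :: "('a quad \<times> 'a quad) option set" where "I = insert None (Some ` class_index)"
  show ?thesis
  proof (rule colorable_by_classes[where I = I and C = C])
    show "finite I" by (simp add: I_def class_index)
    have "card I \<le> Suc (card (class_index :: ('a quad \<times> 'a quad) set))"
      unfolding I_def by (simp add: card_insert_if card_image class_index(1))
    then show "card I \<le> (\<Sum>i<3. CARD('a) ^ i)"
      using class_index(2)[where 'a = 'a] by (simp add: eval_nat_numeral)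
  next
    fix l :: "'a flat" assume l: "l \<in> pg_lines 3"
    show "\<exists>i\<in>I. l \<in> C i"
    proof (cases "l \<in> central_class")
      case True
      then show ?thesis by (intro bexI[of _ None]) (auto simp: C_def I_def)
    next
      case False
      then obtain a b where "a \<noteq> 0" "l \<in> derived_class t a b" using line_in_some_class[OF l t] by blast
      then obtain a' b' where "(a', b') \<in> class_index" "l \<in> derived_class t a' b'"
        using normalized_class[of a t b] by blast
      then show ?thesis by (intro bexI[of _ "Some (a', b')"]) (auto simp: C_def I_def)
    qed
  next
    fix i :: "('a quad \<times> 'a quad) option" and l m :: "'a flat" and v
    assume i: "i \<in> I" and lm: "l \<in> C i" "m \<in> C i" and v: "v \<noteq> 0" "v \<in> l" "v \<in> m"
    show "l = m"
    proof (cases i)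
      case None
      then show ?thesis using central_class_disjoint[OF _ _ v] lm by (simp add: C_def)
    next
      case (Some p)
      then obtain a b where p: "i = Some (a, b)" by (cases p) simp
      then have "(a, b) \<in> class_index" using i by (auto simp: I_def)
      then have "a \<noteq> 0" by (rule class_index_nonzero)
      then show ?thesis using derived_class_disjoint[OF t(1) _ _ _ v] lm p by (simp add: C_def)
    qed
  qed
qed

section \<open>Parallelisms over the field with two elements\<close>

type_synonym bits4 = "bool \<times> bool \<times> bool \<times> bool"

definition bits :: "nat \<Rightarrow> bits4" where
  "bits n = (odd n, odd (n div 2), odd (n div 4), odd (n div 8))"

fun xor4 :: "bits4 \<Rightarrow> bits4 \<Rightarrow> bits4" where
  "xor4 (a, b, c, d) (a', b', c', d') = (a \<noteq> a', b \<noteq> b', c \<noteq> c', d \<noteq> d')"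

definition zero4 :: bits4 where "zero4 = (False, False, False, False)"

text \<open>The points are the numbers from 1 to 15 in binary. Each row is the image of the preceding one under
  multiplication by a generator of the field with eight elements on the three low bits, with the high
  bit fixed.\<close>
definition schoolgirls :: "nat list list list" where
  "schoolgirls =
   [[[1, 2, 3], [4, 10, 14], [5, 8, 13], [6, 9, 15], [7, 11, 12]],
    [[1, 8, 9], [2, 4, 6], [3, 12, 15], [5, 11, 14], [7, 10, 13]],
    [[1, 14, 15], [2, 8, 10], [3, 4, 7], [5, 9, 12], [6, 11, 13]],
    [[1, 10, 11], [2, 13, 15], [3, 5, 6], [4, 8, 12], [7, 9, 14]],
    [[1, 6, 7], [2, 12, 14], [3, 8, 11], [4, 9, 13], [5, 10, 15]],
    [[1, 12, 13], [2, 5, 7], [3, 9, 10], [4, 11, 15], [6, 8, 14]],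
    [[1, 4, 5], [2, 9, 11], [3, 13, 14], [6, 10, 12], [7, 8, 15]]]"

definition schoolgirls4 :: "bits4 list list list" where
  "schoolgirls4 = map (map (map bits)) schoolgirls"

lemma schoolgirls_cover:
  "\<forall>p q. p \<noteq> zero4 \<longrightarrow> q \<noteq> zero4 \<longrightarrow> p \<noteq> q \<longrightarrow>
    list_ex (list_ex (\<lambda>t. p \<in> set t \<and> q \<in> set t \<and> xor4 p q \<in> set t)) schoolgirls4"
  by code_simp

lemma schoolgirls_disjoint:
  "list_all (\<lambda>S. list_all (\<lambda>t. list_all (\<lambda>t'. t = t' \<or> set t \<inter> set t' = {}) S) S) schoolgirls4"
  "list_all (list_all (\<lambda>t. length t = 3)) schoolgirls4"
  by code_simp+

lemma length_schoolgirls4: "length schoolgirls4 = 7"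
  by (simp add: schoolgirls4_def schoolgirls_def)

definition code4 :: "(nat \<Rightarrow> 'a::zero) \<Rightarrow> bits4" where
  "code4 v = (v 0 \<noteq> 0, v 1 \<noteq> 0, v 2 \<noteq> 0, v 3 \<noteq> 0)"

lemma binary_field:
  assumes "CARD('a::{field,finite}) = 2"
  shows "(x :: 'a) = 0 \<or> x = 1" "(1 :: 'a) + 1 = 0"
proof -
  have "card {0, 1::'a} = CARD('a)" using assms by simp
  then have U: "{0, 1::'a} = UNIV" by (intro card_subset_eq) auto
  then show "(x :: 'a) = 0 \<or> x = 1" by blast
  have "(1 :: 'a) + 1 \<in> {0, 1}" unfolding U by (rule UNIV_I)
  moreover have "(1 :: 'a) + 1 \<noteq> 1"
    using add_left_cancel[of "1 :: 'a" 1 0] unfolding add_0_right by simp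
  ultimately show "(1 :: 'a) + 1 = 0" by blast
qed

lemma parallelism_binary:
  assumes q: "CARD('a::{field,finite}) = 2"
  shows "colorable (pg_lines 3 :: 'a flat set) (\<Sum>i<3. CARD('a) ^ i)"
proof -
  note F = binary_field(1)[OF q] and F2 = binary_field(2)[OF q]
  have inj: "v = w" if "v \<in> ambient 3" "w \<in> ambient 3" "code4 v = code4 w" for v w :: "nat \<Rightarrow> 'a"
  proof
    fix i :: nat
    have "i = 0 \<or> i = 1 \<or> i = 2 \<or> i = 3 \<or> 3 < i" by linarith
    moreover have "v j = w j" if "(v j = 0) = (w j = 0)" for j using F[of "v j"] F[of "w j"] that by auto
    ultimately show "v i = w i" using that by (auto simp: code4_def ambient_def)
  qed
  have add: "code4 (v + w) = xor4 (code4 v) (code4 w)" for v w :: "nat \<Rightarrow> 'a"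
  proof -
    have "(v i + w i \<noteq> 0) = ((v i \<noteq> 0) \<noteq> (w i \<noteq> 0))" for i using F[of "v i"] F[of "w i"] F2 by auto
    then show ?thesis by (simp add: code4_def)
  qed
  have code_0: "code4 v \<noteq> zero4" if "v \<in> ambient 3" "v \<noteq> 0" for v :: "nat \<Rightarrow> 'a"
    using inj[of v 0] that by (auto simp: code4_def zero4_def ambient_def)
  define C where "C i = {l :: 'a flat. \<exists>t \<in> set (schoolgirls4 ! i). code4 ` (l - {0}) \<subseteq> set t}" for i
  have l': "card (l - {0}) = 3" "inj_on code4 (l - {0})" if "l \<in> pg_lines 3" for l :: "'a flat"
  proof -
    have "0 \<in> l" "card l = 4" "l \<subseteq> ambient 3"
      using that fvs.subspace_0 by (auto simp: pg_lines_iff q)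
    then show "card (l - {0}) = 3" by (simp add: card_Diff_singleton)
    show "inj_on code4 (l - {0})" using inj \<open>l \<subseteq> ambient 3\<close> by (auto simp: inj_on_def)
  qed
  show ?thesis
  proof (rule colorable_by_classes[where I = "{..<7}" and C = C])
    show "finite {..<7::nat}" "card {..<7::nat} \<le> (\<Sum>i<3. CARD('a) ^ i)"
      by (simp_all add: q eval_nat_numeral)
  next
    fix l :: "'a flat" assume l: "l \<in> pg_lines 3"
    then have sub: "l \<subseteq> ambient 3" and "fvs.subspace l" "card l = CARD('a) ^ 2" by (auto simp: pg_lines_iff)
    then obtain v w where vw: "v \<in> l" "w \<in> l" "indep2 v w" "l = plane v w" using line_basis by blast
    have nz: "v \<noteq> 0" "w \<noteq> 0" "v \<noteq> w"
    proof -
      have i: "s = 0 \<and> r = 0" if "fscale s v + fscale r w = 0" for s r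
        using vw(3) that unfolding indep2_def by blast
      show "v \<noteq> 0" using i[of 1 0] by auto
      show "w \<noteq> 0" using i[of 0 1] by auto
      show "v \<noteq> w" using i[of 1 "- 1"] by auto
    qed
    have "code4 v \<noteq> zero4" "code4 w \<noteq> zero4" "code4 v \<noteq> code4 w"
      using code_0 inj nz vw sub by blast+
    then have "list_ex (list_ex (\<lambda>t. code4 v \<in> set t \<and> code4 w \<in> set t \<and> xor4 (code4 v) (code4 w) \<in> set t)) schoolgirls4"
      using schoolgirls_cover by blast
    then obtain S t where S: "S \<in> set schoolgirls4" "t \<in> set S"
      "code4 v \<in> set t" "code4 w \<in> set t" "code4 (v + w) \<in> set t"
      unfolding add list_ex_iff by blast
    obtain i where i: "i < 7" "schoolgirls4 ! i = S"
      using S(1) length_schoolgirls4 by (metis in_set_conv_nth)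
    have "code4 x \<in> set t" if x: "x \<in> l" "x \<noteq> 0" for x
    proof -
      obtain s r where "x = fscale s v + fscale r w" using x vw(4) by (auto simp: plane_def)
      then have "x = v \<or> x = w \<or> x = v + w"
        using F[of s] F[of r] x(2) by auto
      then show ?thesis using S by blast
    qed
    then have "l \<in> C i" using S(2) i(2) by (auto simp: C_def)
    then show "\<exists>i\<in>{..<7}. l \<in> C i" using i(1) by blast
  next
    fix i :: nat and l m :: "'a flat" and v
    assume i: "i \<in> {..<7}" and l: "l \<in> pg_lines 3" and m: "m \<in> pg_lines 3" and lm: "l \<in> C i" "m \<in> C i"
      and v: "v \<noteq> 0" "v \<in> l" "v \<in> m"
    obtain t where t: "t \<in> set (schoolgirls4 ! i)" "code4 ` (l - {0}) \<subseteq> set t" using lm(1) by (auto simp: C_def)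
    obtain t' where t': "t' \<in> set (schoolgirls4 ! i)" "code4 ` (m - {0}) \<subseteq> set t'" using lm(2) by (auto simp: C_def)
    have Si: "schoolgirls4 ! i \<in> set schoolgirls4" using i length_schoolgirls4 by simp
    have "code4 v \<in> set t \<inter> set t'" using t t' v by blast
    then have "t = t'" using schoolgirls_disjoint(1) Si t(1) t'(1) unfolding list_all_iff by blast
    have "length t = 3" using schoolgirls_disjoint(2) Si t(1) unfolding list_all_iff by blast
    then have ct: "card (set t) \<le> 3" by (metis card_length)
    have im: "code4 ` (k - {0}) = set t" if "k \<in> pg_lines 3" "code4 ` (k - {0}) \<subseteq> set t" for k :: "'a flat"
      using card_seteq[OF _ that(2)] ct l'[OF that(1)] by (simp add: card_image)
    have eq: "code4 ` (l - {0}) = code4 ` (m - {0})"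
      using im[OF l t(2)] im[OF m t'(2)[folded \<open>t = t'\<close>]] by simp
    have sub: "l - {0} \<subseteq> ambient 3" "m - {0} \<subseteq> ambient 3" using l m by (auto simp: pg_lines_iff)
    have "inj_on code4 (ambient 3 :: 'a flat)" using inj by (auto simp: inj_on_def)
    then have "l - {0} = m - {0}" using inj_on_image_eq_iff[OF _ sub] eq by blast
    moreover have "0 \<in> l" "0 \<in> m" using l m fvs.subspace_0 by (auto simp: pg_lines_iff)
    ultimately show "l = m" by blast
  qed
qed

section \<open>Recursion on the dimension\<close>

lemma geometric_div:
  assumes "2 \<le> (q::nat)"
  shows "(q ^ n - 1) div (q - 1) = (\<Sum>i<n. q ^ i)"
proof -
  have "(q - 1) * (\<Sum>i<n. q ^ i) = q ^ n - 1"
  proof -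
    have "int q ^ n - 1 = (int q - 1) * (\<Sum>i<n. int q ^ i)" by (rule power_diff_1_eq)
    then have "int (q ^ n - 1) = int ((q - 1) * (\<Sum>i<n. q ^ i))"
      using assms by (simp add: of_nat_diff)
    then show ?thesis by (simp only: of_nat_eq_iff)
  qed
  then have "(q ^ n - 1) div (q - 1) = ((q - 1) * (\<Sum>i<n. q ^ i)) div (q - 1)" by simp
  then show ?thesis using assms by simp
qed

text \<open>The frame has \<open>(q\<^sup>2 + 1) * (q + 1)\<close> spreads, each used for \<open>q ^ (n - 4)\<close> colors; the colors of the
  fillings beyond the slots are added. For the hole over \<open>y0\<close> the \<open>q + 1\<close> spreads through \<open>y0\<close> are
  discounted.\<close>
lemma dimension_step:
  assumes n: "5 \<le> n" and E: "property_E TYPE('a::{field,finite})"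
    and full: "colorable (pg_lines (n - 2) :: 'a flat set) c"
    and hole: "hole_colorable TYPE('a) (n - 2) c"
  defines "c' \<equiv> (CARD('a) ^ 4 - 1) div (CARD('a) - 1) * CARD('a) ^ (n - 4)
    + (c - CARD('a) ^ (n - 4) * (CARD('a) + 1))"
  shows "colorable (pg_lines n :: 'a flat set) c'" "hole_colorable TYPE('a) n c'"
proof -
  let ?q = "CARD('a)"
  have q: "2 \<le> ?q" by (rule two_le_card_field)
  define N where "N = (?q ^ 4 - 1) div (?q - 1)"
  obtain P :: "'a flat set" and M where P: "spread P" and M: "\<forall>S\<in>#M. spread S" "size M = N"
    "\<forall>l\<in>P. size {#S \<in># M. l \<in> S#} = ?q + 1"
    "\<forall>l\<in>pg_lines 3 - P. size {#S \<in># M. l \<in> S#} = ?q"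
    "\<forall>S\<in>#M. \<not> (\<exists>l\<in>P. \<exists>m\<in>P. l \<noteq> m \<and> l \<in> S \<and> m \<in> S)"
    using E unfolding property_E_def Let_def N_def by auto
  obtain xs where xs: "mset xs = M" using ex_mset by blast
  have len: "length xs = N" using M(2) xs by (metis size_mset)
  have nth: "xs ! i \<in># M" if "i < N" for i using that len xs by (metis nth_mem set_mset_mset)
  have mult: "card {i. i < N \<and> l \<in> xs ! i} = size {#S \<in># M. l \<in> S#}" for l
    unfolding xs[symmetric] by (simp add: length_filter_conv_card len flip: mset_filter)
  obtain y0 where y0: "y0 \<in> P" by (rule spread_nonempty[OF P])
  have n2: "n - 2 + 1 = n - 1" "n - 2 - 1 = n - 3" "n - 2 - 2 = n - 4" "2 \<le> n - 2" using n by auto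
  have yP: "y \<in> pg_lines 3" "fvs.subspace y" if "y \<in> P" for y
    using spread_line[OF P that] by (auto simp: pg_lines_iff)
  have cc: "fvs.subspace (cone n y)" "card (cone n y) = ?q ^ (n - 2 + 1)" if "y \<in> P" for y
    using subspace_cone[OF yP(2)[OF that]] card_cone[OF _ yP(1)[OF that], of n] n unfolding n2 by auto
  obtain f where "line_coloring (pg_lines (n - 2) :: 'a flat set) c f"
    using full unfolding colorable_def by blast
  then obtain F where F: "proper_on (lines_of (cone n y0)) F" "F ` lines_of (cone n y0) \<subseteq> {..<c}"
    by (rule coloring_transport[OF cc[OF y0]])
  define Q where "Q y G \<longleftrightarrow> proper_on {l \<in> lines_of (cone n y). \<not> l \<subseteq> vertex n} G \<and>
      G ` {l \<in> lines_of (cone n y). \<not> l \<subseteq> vertex n} \<subseteq> {..<c} \<and>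
      (\<forall>l v. l \<in> lines_of (cone n y) \<longrightarrow> \<not> l \<subseteq> vertex n \<longrightarrow> v \<noteq> 0 \<longrightarrow> v \<in> l \<longrightarrow> v \<in> vertex n \<longrightarrow>
        G l < ?q ^ (n - 4) * (?q + 1))" for y and G :: "'a flat \<Rightarrow> nat"
  have "\<exists>G. Q y G" if y: "y \<in> P" for y
  proof -
    have cv: "card (vertex n :: 'a flat) = ?q ^ (n - 2 - 1)" using n unfolding n2 by (simp add: card_vertex)
    show ?thesis
    proof (rule hole_coloring_transport[OF n2(4) subspace_vertex cc(1)[OF y] vertex_subset_cone[OF yP(2)[OF y]] cv cc(2)[OF y] hole])
      fix G assume "proper_on {l \<in> lines_of (cone n y). \<not> l \<subseteq> vertex n} G"
        "G ` {l \<in> lines_of (cone n y). \<not> l \<subseteq> vertex n} \<subseteq> {..<c}"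
        "\<And>l v. l \<in> lines_of (cone n y) \<Longrightarrow> \<not> l \<subseteq> vertex n \<Longrightarrow> v \<noteq> 0 \<Longrightarrow> v \<in> l \<Longrightarrow> v \<in> vertex n \<Longrightarrow>
          G l < ?q ^ (n - 2 - 2) * (?q + 1)"
      then have "Q y G" unfolding Q_def n2 by simp
      then show "\<exists>G. Q y G" by blast
    qed
  qed
  then have "\<exists>G. \<forall>y\<in>P. Q y (G y)" by (intro bchoice ballI)
  then obtain G where Q: "\<And>y. y \<in> P \<Longrightarrow> Q y (G y)" by blast
  note G = Q[unfolded Q_def, THEN conjunct1] Q[unfolded Q_def, THEN conjunct2, THEN conjunct1]
    Q[unfolded Q_def, THEN conjunct2, THEN conjunct2, rule_format]
  interpret spread_frame n c N P "\<lambda>i. xs ! i" y0 "G(y0 := F)" "?q ^ (n - 4) * (?q + 1)"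
  proof unfold_locales
    show "5 \<le> n" "spread P" "y0 \<in> P" by fact+
    show "\<And>i. i < N \<Longrightarrow> spread (xs ! i)" using nth M(1) by blast
    show "\<And>l. l \<in> P \<Longrightarrow> card {i. i < N \<and> l \<in> xs ! i} = ?q + 1" using mult M(3) by simp
    show "\<And>l. l \<in> pg_lines 3 - P \<Longrightarrow> card {i. i < N \<and> l \<in> xs ! i} = ?q" using mult M(4) by simp
    show "\<And>i l m. i < N \<Longrightarrow> l \<in> P \<Longrightarrow> m \<in> P \<Longrightarrow> l \<in> xs ! i \<Longrightarrow> m \<in> xs ! i \<Longrightarrow> l = m"
      using nth M(5) by blast
  qed (use F G in auto)
  obtain f where f: "line_coloring (pg_lines n :: 'a flat set) c' f"
    "\<And>l. l \<in> ipg_incident_lines n (cone n y0) \<Longrightarrow> f l < (N - (?q + 1)) * ?q ^ (n - 4)"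
    using frame_coloring unfolding c'_def N_def[symmetric] by blast
  then show "colorable (pg_lines n :: 'a flat set) c'" unfolding colorable_def by blast
  have "N = 1 + ?q + ?q ^ 2 + ?q ^ 3"
    unfolding N_def geometric_div[OF q] by (simp add: eval_nat_numeral)
  then have "N - (?q + 1) = ?q ^ 2 * (?q + 1)" by (simp add: eval_nat_numeral)
  moreover have "?q ^ (n - 2) = ?q ^ 2 * ?q ^ (n - 4)"
  proof -
    have "n - 2 = 2 + (n - 4)" using n by simp
    then show ?thesis by (simp only: power_add)
  qed
  ultimately have *: "(N - (?q + 1)) * ?q ^ (n - 4) = ?q ^ (n - 2) * (?q + 1)"
    by (simp only: mult_ac)
  have "cone n y0 \<in> pg_subspaces n (n - 2)"
    using cc[OF y0] by (auto simp: pg_subspaces_iff cone_def)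
  moreover have "line_coloring (ipg_lines n (cone n y0)) c' f"
    using f(1) by (auto simp: line_coloring_def ipg_lines_def)
  ultimately show "hole_colorable TYPE('a) n c'"
    unfolding hole_colorable_def using f(2)[unfolded *] by blast
qed

text \<open>The excess \<open>d\<close> over the number of lines through a point is kept by each step: it is \<open>0\<close> in odd
  dimension and \<open>q + 1\<close> in even dimension.\<close>
lemma colorable_hole_recursion:
  fixes d :: nat
  assumes E: "property_E TYPE('a::{field,finite})" and m: "3 \<le> m"
    and base: "colorable (pg_lines m :: 'a flat set) ((\<Sum>i<m. CARD('a) ^ i) + d)"
      "hole_colorable TYPE('a) m ((\<Sum>i<m. CARD('a) ^ i) + d)"
  shows "colorable (pg_lines (m + 2 * j) :: 'a flat set) ((\<Sum>i<m + 2 * j. CARD('a) ^ i) + d) \<and>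
    hole_colorable TYPE('a) (m + 2 * j) ((\<Sum>i<m + 2 * j. CARD('a) ^ i) + d)"
proof (induction j)
  case 0
  then show ?case using base by simp
next
  case (Suc j)
  let ?q = "CARD('a)"
  have q: "2 \<le> ?q" by (rule two_le_card_field)
  define r where "r = m + 2 * j - 2"
  have r: "r + 4 - 2 = m + 2 * j" "r + 4 - 4 = r" "m + 2 * Suc j = r + 4" "m + 2 * j = r + 2" "5 \<le> r + 4"
    using m by (auto simp: r_def)
  have c: "(?q ^ 4 - 1) div (?q - 1) * ?q ^ r + ((\<Sum>i<m + 2 * j. ?q ^ i) + d - ?q ^ r * (?q + 1))
    = (\<Sum>i<r + 4. ?q ^ i) + d"
    unfolding geometric_div[OF q] r(4) by (simp add: eval_nat_numeral algebra_simps)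
  show ?case
    using dimension_step[OF r(5) E, unfolded r(1,2), of "(\<Sum>i<m + 2 * j. ?q ^ i) + d", unfolded c]
      Suc.IH unfolding r(3) by blast
qed

lemma ipg_incident_subset: "ipg_incident_lines n H \<subseteq> ipg_lines n H" "ipg_lines n H \<subseteq> pg_lines n"
  by (auto simp: ipg_incident_lines_def ipg_lines_def)

lemma hole_colorable_of_card:
  fixes H :: "'a::{field,finite} flat"
  assumes H: "H \<in> pg_subspaces n (n - 2)" and f: "line_coloring (ipg_lines n H) c f"
    and K: "f ` ipg_incident_lines n H \<subseteq> K" "K \<subseteq> {..<c}" "card K \<le> CARD('a) ^ (n - 2) * (CARD('a) + 1)"
  shows "hole_colorable TYPE('a) n c"
proof -
  obtain h where h: "inj_on h {..<c}" "h ` {..<c} \<subseteq> {..<c}"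
    "h ` K \<subseteq> {..<CARD('a) ^ (n - 2) * (CARD('a) + 1)}"
    using relabel_colors[of "{..<c}" c K] K by (metis card_lessThan finite_lessThan order_refl)
  have L: "ipg_lines n H \<subseteq> lines_of (ambient n)"
    unfolding pg_lines_eq_lines_of[symmetric] ipg_lines_def by blast
  have p: "proper_on (ipg_lines n H) f" "f ` ipg_lines n H \<subseteq> {..<c}"
    using f unfolding line_coloring_iff_proper_on[OF L] by auto
  have "line_coloring (ipg_lines n H) c (\<lambda>l. h (f l))"
    unfolding line_coloring_iff_proper_on[OF L]
    using proper_on_relabel[OF p(1) h(1) p(2)] p(2) h(2) by blast
  moreover have "h (f l) < CARD('a) ^ (n - 2) * (CARD('a) + 1)" if "l \<in> ipg_incident_lines n H" for l
    using that K(1) h(3) by blast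
  ultimately show ?thesis unfolding hole_colorable_def using H by blast
qed

text \<open>In a parallelism of the three-dimensional space, a line \<open>H\<close> is alone among the lines meeting it
  to have its color.\<close>
lemma hole_colorable_3:
  assumes "colorable (pg_lines 3 :: 'a::{field,finite} flat set) (\<Sum>i<3. CARD('a) ^ i)"
  shows "hole_colorable TYPE('a) 3 (\<Sum>i<3. CARD('a) ^ i)"
proof -
  let ?c = "\<Sum>i<3. CARD('a) ^ i"
  obtain f where f: "line_coloring (pg_lines 3 :: 'a flat set) ?c f"
    using assms unfolding colorable_def by blast
  define H :: "'a flat" where "H = ambient 1"
  have H: "H \<in> pg_lines 3"
    using subspace_ambient[of 1] card_ambient[of 1, where 'a = 'a] ambient_mono[of 1 3]
    by (auto simp: H_def pg_lines_iff power2_eq_square)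
  let ?K = "{..<?c} - {f H}"
  show ?thesis
  proof (rule hole_colorable_of_card[of H])
    show "H \<in> pg_subspaces 3 (3 - 2)" using H by simp
    show "line_coloring (ipg_lines 3 H) ?c f"
      using f ipg_incident_subset(2) unfolding line_coloring_def by blast
    show "f ` ipg_incident_lines 3 H \<subseteq> ?K"
    proof (rule image_subsetI)
      fix l assume l: "l \<in> ipg_incident_lines 3 H"
      then have l': "l \<in> pg_lines 3" "intersecting l H" "l \<noteq> H"
        by (auto simp: ipg_incident_lines_def ipg_lines_def)
      then show "f l \<in> ?K" using line_coloringD[OF f l'(1)] H by auto
    qed
    have "card ?K = ?c - 1" using line_coloringD(1)[OF f H] by (simp add: card_Diff_singleton)
    then show "card ?K \<le> CARD('a) ^ (3 - 2) * (CARD('a) + 1)"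
      by (simp add: eval_nat_numeral algebra_simps)
  qed auto
qed

section \<open>The chromatic indices\<close>

lemma chromatic_index_eqI:
  assumes "colorable L c" "\<And>c' f. line_coloring L c' f \<Longrightarrow> c \<le> c'"
  shows "chromatic_index L = c"
  unfolding chromatic_index_def using assms by (intro Least_equality) (auto simp: colorable_def)

lemma colorable_chromatic_index:
  assumes "finite L" shows "colorable L (chromatic_index L)"
proof -
  obtain f where f: "bij_betw f L {0..<card L}" using ex_bij_betw_finite_nat[OF assms] by blast
  have "line_coloring L (card L) f"
    using f by (auto simp: line_coloring_def bij_betw_def inj_on_def)
  then have "\<exists>c f. line_coloring L c f" by blast
  then show ?thesis unfolding colorable_def chromatic_index_def by (rule LeastI_ex)
qed

lemma parallelism_3: "colorable (pg_lines 3 :: 'a::{field,finite} flat set) (\<Sum>i<3. CARD('a) ^ i)"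
proof (cases "CARD('a) = 2")
  case True
  then show ?thesis by (rule parallelism_binary)
next
  case False
  then show ?thesis using two_le_card_field[where 'a = 'a] by (intro parallelism_large) simp
qed

theorem theorem3p1:
  fixes q :: nat
  assumes "primepow q" and "CARD('a::{field,finite}) = q"
  shows
    "(property_E TYPE('a) \<longrightarrow>
        (\<forall>n\<ge>5. odd n \<longrightarrow>
           chromatic_index (pg_lines n :: 'a flat set) = (q ^ n - 1) div (q - 1)))
     \<and>
     (property_E TYPE('a) \<and>
      chromatic_index (pg_lines 4 :: 'a flat set) = (q ^ 4 - 1) div (q - 1) + q + 1 \<and>
      (\<exists>H \<in> pg_subspaces 4 2. \<exists>f :: 'a flat \<Rightarrow> nat.
         line_coloring (ipg_lines 4 H) ((q ^ 4 - 1) div (q - 1) + q + 1) f \<and>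
         card (f ` ipg_incident_lines 4 H) = q ^ 2 * (q + 1)) \<longrightarrow>
        (\<forall>n\<ge>6. even n \<longrightarrow>
           chromatic_index (pg_lines n :: 'a flat set) = (q ^ n - 1) div (q - 1) + q + 1))"
proof -
  have q: "q = CARD('a)" using assms(2) by simp
  have geo: "(q ^ n - 1) div (q - 1) = (\<Sum>i<n. CARD('a) ^ i)" for n
    unfolding q by (rule geometric_div[OF two_le_card_field])
  show ?thesis
  proof (intro conjI impI allI)
    fix n :: nat assume E: "property_E TYPE('a)" and n: "5 \<le> n" "odd n"
    have "n = 3 + 2 * ((n - 3) div 2)" using n by presburger
    then obtain j where j: "n = 3 + 2 * j" by blast
    have "colorable (pg_lines n :: 'a flat set) (\<Sum>i<n. CARD('a) ^ i)"
      using colorable_hole_recursion[OF E order_refl, of 0 j] parallelism_3[where 'a = 'a]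
        hole_colorable_3[OF parallelism_3[where 'a = 'a]] unfolding j by simp
    then show "chromatic_index (pg_lines n :: 'a flat set) = (q ^ n - 1) div (q - 1)"
      using chromatic_lower_bound[of n, where 'a = 'a] unfolding geo[symmetric] q
      by (intro chromatic_index_eqI) auto
  next
    fix n :: nat
    assume A: "property_E TYPE('a) \<and>
      chromatic_index (pg_lines 4 :: 'a flat set) = (q ^ 4 - 1) div (q - 1) + q + 1 \<and>
      (\<exists>H \<in> pg_subspaces 4 2. \<exists>f :: 'a flat \<Rightarrow> nat.
         line_coloring (ipg_lines 4 H) ((q ^ 4 - 1) div (q - 1) + q + 1) f \<and>
         card (f ` ipg_incident_lines 4 H) = q ^ 2 * (q + 1))" and n: "6 \<le> n" "even n"
    let ?c = "(\<Sum>i<4. CARD('a) ^ i) + (CARD('a) + 1)"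
    have c: "(q ^ 4 - 1) div (q - 1) + q + 1 = ?c" unfolding geo unfolding q by simp
    from A obtain H :: "'a flat" and f where H: "H \<in> pg_subspaces 4 2"
      and f: "line_coloring (ipg_lines 4 H) ?c f"
      and K: "card (f ` ipg_incident_lines 4 H) = CARD('a) ^ 2 * (CARD('a) + 1)"
      unfolding c unfolding q by blast
    have hole: "hole_colorable TYPE('a) 4 ?c"
    proof (rule hole_colorable_of_card[where K = "f ` ipg_incident_lines 4 H"])
      show "f ` ipg_incident_lines 4 H \<subseteq> {..<?c}"
        using f ipg_incident_subset(1)[of 4 H] unfolding line_coloring_def by blast
    qed (use H f K in auto)
    have full: "colorable (pg_lines 4 :: 'a flat set) ?c"
      using colorable_chromatic_index[OF finite_pg_subspaces[of 4 1, where 'a = 'a]] A unfolding c by simp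
    have "n = 4 + 2 * ((n - 4) div 2)" using n by presburger
    then obtain j where j: "n = 4 + 2 * j" by blast
    have E: "property_E TYPE('a)" using A by blast
    have "colorable (pg_lines n :: 'a flat set) ((\<Sum>i<n. CARD('a) ^ i) + (CARD('a) + 1))"
      using colorable_hole_recursion[OF E _ full hole, of j] unfolding j by simp
    then have "colorable (pg_lines n :: 'a flat set) ((q ^ n - 1) div (q - 1) + q + 1)"
      unfolding geo unfolding q by (simp add: add.assoc)
    then show "chromatic_index (pg_lines n :: 'a flat set) = (q ^ n - 1) div (q - 1) + q + 1"
      using chromatic_lower_bound_even[of n, where 'a = 'a] n unfolding q
      by (intro chromatic_index_eqI) auto
  qed
qed

end
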